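(* Let $G$ be a claw-free graph and let $G^T$ be a Tutte-closure of $G$. Then $G^T$ is the line graph of a hypergraph of rank at most $3$.
   Context: All graphs are finite, without loops or multiple edges. A graph is claw-free if it contains no induced $K_{1,3}$. For a vertex $x$ of a graph $G$, the local completion $G^*_x$ is the graph obtained from $G$ by adding all possible edges among the vertices of $N_G(x)$. A path $P$ in $G$ is a Tutte path if every component of $G-V(P)$ has at most $\min\{3,|V(P)|-1\}$ neighbours on $P$. An $(a,b)$-path is a path from $a$ to $b$; it is maximal if there is no $(a,b)$-path $P'$ whose vertex set properly contains $V(P)$. A graph is Tutte-connected if for every pair of its vertices $a,b$ there is a maximal $(a,b)$-path which is a Tutte path. A Tutte-closure $G^T$ of $G$ is defined as follows: if $G$ is Tutte-connected, $G^T$ is the complete graph on $V(G)$; otherwise, one repeatedly performs local completion at a vertex for which the resulting graph is still not Tutte-connected, as long as such a vertex exists, and $G^T$ is a resulting graph (when no such vertex exists). A hypergraph is a collection of subsets (edges, repetitions allowed) of a ground set; its rank is the maximum size of an edge. The line graph of a hypergraph $H$ has vertex set $E(H)$, two vertices being adjacent iff the corresponding edges have a common element. *)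

theory Defs
  imports "Graph_Theory.Graph_Theory" "Graph_Theory.Kuratowski"
begin

text \<open>
  Finite simple graphs are modelled by the locale \<open>pair_graph\<close>: every edge \<open>uv\<close> is present as the
  two arcs \<open>(u, v)\<close> and \<open>(v, u)\<close>. Paths are represented by their vertex sequences (\<open>vpath\<close>), so the
  vertex set of a path \<open>p\<close> is \<open>set p\<close>.
\<close>

definition nbhd :: "'a pair_pre_digraph \<Rightarrow> 'a \<Rightarrow> 'a set" where
  "nbhd G x = {v. (x, v) \<in> parcs G}"

definition claw_free :: "'a pair_pre_digraph \<Rightarrow> bool" where
  "claw_free G \<longleftrightarrow>
     \<not> (\<exists>H. induced_subgraph H (with_proj G) \<and> complete_bipartite_digraph 1 3 H)"

definition local_completion :: "'a pair_pre_digraph \<Rightarrow> 'a \<Rightarrow> 'a pair_pre_digraph" where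
  "local_completion G x =
     \<lparr>pverts = pverts G,
      parcs = parcs G \<union> {(u, v). u \<in> nbhd G x \<and> v \<in> nbhd G x \<and> u \<noteq> v}\<rparr>"

definition complete_graph_on :: "'a set \<Rightarrow> 'a pair_pre_digraph" where
  "complete_graph_on V = \<lparr>pverts = V, parcs = {(u, v). u \<in> V \<and> v \<in> V \<and> u \<noteq> v}\<rparr>"

text \<open>
  Graphs are symmetric as digraphs, so the strong components of \<open>G - V(P)\<close> are its connected
  components.
\<close>

definition tutte_path :: "'a pair_pre_digraph \<Rightarrow> 'a list \<Rightarrow> bool" where
  "tutte_path G p \<longleftrightarrow> vpath p (with_proj G) \<and>
     (\<forall>C \<in> pre_digraph.sccs_verts (with_proj G \<restriction> (pverts G - set p)).
        card {v \<in> set p. \<exists>u \<in> C. v \<in> nbhd G u} \<le> min 3 (card (set p) - 1))"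

definition path_between :: "'a pair_pre_digraph \<Rightarrow> 'a \<Rightarrow> 'a \<Rightarrow> 'a list \<Rightarrow> bool" where
  "path_between G a b p \<longleftrightarrow> vpath p (with_proj G) \<and> hd p = a \<and> last p = b"

definition maximal_path_between :: "'a pair_pre_digraph \<Rightarrow> 'a \<Rightarrow> 'a \<Rightarrow> 'a list \<Rightarrow> bool" where
  "maximal_path_between G a b p \<longleftrightarrow>
     path_between G a b p \<and> \<not> (\<exists>p'. path_between G a b p' \<and> set p \<subset> set p')"

text \<open>A pair of vertices means two distinct vertices.\<close>

definition tutte_connected :: "'a pair_pre_digraph \<Rightarrow> bool" where
  "tutte_connected G \<longleftrightarrow>
     (\<forall>a \<in> pverts G. \<forall>b \<in> pverts G. a \<noteq> b \<longrightarrow>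
        (\<exists>p. maximal_path_between G a b p \<and> tutte_path G p))"

text \<open>
  Completing at a vertex whose neighbourhood is already a clique changes nothing and could be
  repeated forever; such vacuous steps are excluded by \<open>H \<noteq> G\<close>.
\<close>

definition tutte_step :: "'a pair_pre_digraph \<Rightarrow> 'a pair_pre_digraph \<Rightarrow> bool" where
  "tutte_step G H \<longleftrightarrow>
     (\<exists>x \<in> pverts G. H = local_completion G x) \<and> H \<noteq> G \<and> \<not> tutte_connected H"

text \<open>The result may depend on the choices made, so being a closure of \<open>G\<close> is a relation.\<close>

definition tutte_closure :: "'a pair_pre_digraph \<Rightarrow> 'a pair_pre_digraph \<Rightarrow> bool" where
  "tutte_closure G H \<longleftrightarrow>
     (if tutte_connected G then H = complete_graph_on (pverts G)
      else tutte_step\<^sup>*\<^sup>* G H \<and> \<not> (\<exists>H'. tutte_step H H'))"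

text \<open>Edges are indexed by names so that the same vertex set may occur repeatedly as an edge.\<close>

record ('e, 'v) hypergraph =
  ground :: "'v set"
  edge_names :: "'e set"
  edge_set :: "'e \<Rightarrow> 'v set"

definition finite_hypergraph :: "('e, 'v) hypergraph \<Rightarrow> bool" where
  "finite_hypergraph H \<longleftrightarrow> finite (ground H) \<and> finite (edge_names H) \<and>
     (\<forall>e \<in> edge_names H. edge_set H e \<subseteq> ground H)"

text \<open>The element \<open>0\<close> only matters for a hypergraph without edges, which gets rank \<open>0\<close>.\<close>

definition hypergraph_rank :: "('e, 'v) hypergraph \<Rightarrow> nat" where
  "hypergraph_rank H = Max (insert 0 ((\<lambda>e. card (edge_set H e)) ` edge_names H))"

definition line_graph :: "('e, 'v) hypergraph \<Rightarrow> 'e pair_pre_digraph" where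
  "line_graph H =
     \<lparr>pverts = edge_names H,
      parcs = {(e, f). e \<in> edge_names H \<and> f \<in> edge_names H \<and> e \<noteq> f \<and>
                 edge_set H e \<inter> edge_set H f \<noteq> {}}\<rparr>"

end

theory Submission
  imports Defs
begin

text \<open>
  Let \<open>G\<close> be a Tutte-closure that is not Tutte-connected, and fix distinct vertices \<open>a\<close>, \<open>b\<close> without a
  maximal \<open>(a, b)\<close>-path that is a Tutte path. If \<open>N(x)\<close> is not 2-connected, or is a clique, then \<open>x\<close>
  lies in at most three maximal cliques. Otherwise completing at \<open>x\<close> gives a Tutte-connected graph, and
  the vertex set \<open>W\<close> of a maximal Tutte \<open>(a, b)\<close>-path there is not spanned by any \<open>(a, b)\<close>-path of
  \<open>G\<close>, since such a path would again be maximal and Tutte.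

  Cutting the path at \<open>x\<close> and at its new edges leaves pieces with ends in \<open>N(x)\<close> that can be rearranged
  freely. As \<open>N(x)\<close> has no three independent vertices, three pieces suffice, and rerouting arguments
  for a system with as many steps inside \<open>N(x)\<close> as possible show that \<open>a, b \<in> N(x)\<close> and that the rest
  of \<open>N(x)\<close> splits into two cliques without edges between them: one (\<open>near\<close>) complete to \<open>a\<close> and
  \<open>b\<close>, the other (\<open>far\<close>) meeting each of \<open>N(a)\<close>, \<open>N(b)\<close> in at most one vertex.

  Such an \<open>x\<close> may lie in five maximal cliques, but its triangles with \<open>a\<close> or \<open>b\<close> and a far vertex can
  be left out: their third edge also lies in a clique avoiding \<open>x\<close>. The remaining maximal cliques cover
  all edges and each vertex is in at most three of them; they are the ground set of the hypergraph.
\<close>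

section \<open>Path systems at a vertex\<close>

locale claw_free_rel =
  fixes E :: "'a \<Rightarrow> 'a \<Rightarrow> bool"
  assumes sym: "E u v \<Longrightarrow> E v u"
    and irrefl: "\<not> E u u"
    and no_claw: "E c p \<Longrightarrow> E c q \<Longrightarrow> E c r \<Longrightarrow> p \<noteq> q \<Longrightarrow> p \<noteq> r \<Longrightarrow> q \<noteq> r
      \<Longrightarrow> E p q \<or> E p r \<or> E q r"
begin

lemma commute: "E u v \<longleftrightarrow> E v u"
  using sym by blast

text \<open>\<open>successively_rev\<close> turns the relation around; with this rule the simplifier
  treats a reversed path as a path again.\<close>

lemma successively_flip [simp]: "successively (\<lambda>u v. E v u) p \<longleftrightarrow> successively E p"
proof -
  have "(\<lambda>u v. E v u) = E" by (intro ext iffI) (erule sym)+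
  then show ?thesis by (simp only:)
qed

end

text \<open>\<open>W\<close> stands for the vertex set of a maximal path in the completion at
  \<open>x\<close>. It contains all of \<open>N(x)\<close>, because a missing neighbour could be
  inserted into an added edge of that path.\<close>

locale clique_closing = claw_free_rel +
  fixes x :: 'a and W :: "'a set"
  assumes finite_W: "finite W" and x_in_W: "x \<in> W" and nbrs_in_W: "E x v \<Longrightarrow> v \<in> W"
begin

definition N :: "'a set" where "N = {v. E x v}"

lemma N_iff [simp]: "E x v \<longleftrightarrow> v \<in> N" "E v x \<longleftrightarrow> v \<in> N"
  by (auto simp: N_def commute[of v x])

lemma x_notin_N [simp]: "x \<notin> N"
  using irrefl by (simp flip: N_iff(1))

lemma N_sub_W: "N \<subseteq> W - {x}"
  using nbrs_in_W by auto

lemma three_in_N: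
  "u \<in> N \<Longrightarrow> v \<in> N \<Longrightarrow> w \<in> N \<Longrightarrow> u \<noteq> v \<Longrightarrow> u \<noteq> w \<Longrightarrow> v \<noteq> w \<Longrightarrow> E u v \<or> E u w \<or> E v w"
  using no_claw[of x u v w] by simp

text \<open>Otherwise \<open>y\<close> would be the centre of a claw with leaves \<open>x\<close>,
  \<open>u\<close>, \<open>v\<close>. The edge lets a path bypass \<open>y\<close>.\<close>

lemma outer_nbrs:
  assumes "y \<in> N" "E y u" "E y v" "u \<notin> N" "v \<notin> N" "u \<noteq> x" "v \<noteq> x" "u \<noteq> v"
  shows "E u v"
  using no_claw[of y x u v] assms by auto

definition spans :: "'a \<Rightarrow> 'a \<Rightarrow> 'a list \<Rightarrow> bool" where
  "spans a b p \<longleftrightarrow> p \<noteq> [] \<and> distinct p \<and> successively E p \<and> set p = W \<and> hd p = a \<and> last p = b"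

lemma spans_rev: "spans a b p \<Longrightarrow> spans b a (rev p)"
  by (auto simp: spans_def hd_rev last_rev)

text \<open>The potential that is maximised when a path system is chosen.\<close>

fun inner_steps :: "'a list \<Rightarrow> nat" where
  "inner_steps (u # v # p) = (if u \<in> N \<and> v \<in> N then 1 else 0) + inner_steps (v # p)"
| "inner_steps p = 0"

lemma inner_steps_Cons: "inner_steps (u # p) =
    inner_steps p + (if p \<noteq> [] \<and> u \<in> N \<and> hd p \<in> N then 1 else 0)"
  by (cases p) auto

lemma inner_steps_append: "inner_steps (p @ q) = inner_steps p + inner_steps q +
    (if p \<noteq> [] \<and> q \<noteq> [] \<and> last p \<in> N \<and> hd q \<in> N then 1 else 0)"
  by (induction p rule: inner_steps.induct) (auto simp: inner_steps_Cons)

lemma inner_steps_rev [simp]: "inner_steps (rev p) = inner_steps p"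
  by (induction p) (auto simp: inner_steps_append inner_steps_Cons last_rev)

lemma inner_steps_le: "inner_steps p \<le> length p"
  by (induction p rule: inner_steps.induct) auto

lemmas pathsimps = successively_append_iff successively_Cons hd_append last_append hd_rev last_rev
lemmas stepsimps = inner_steps_append inner_steps_Cons hd_append last_append hd_rev last_rev

text \<open>If \<open>k\<close> is an end of \<open>Q\<close>, then \<open>Q\<close> or its reverse
  will do. Otherwise \<open>Q\<close> closes up to a cycle. By \<open>inner\<close>, some neighbour
  of \<open>k\<close> on it lies in \<open>N\<close>; cutting the cycle between that neighbour and
  \<open>k\<close> loses one inner step, and the closing edge makes up for it.\<close>

lemma reorder_from:
  assumes Q: "distinct Q" "successively E Q" "Q \<noteq> []" "hd Q \<in> N" "last Q \<in> N"
    and closed: "hd Q = last Q \<or> E (hd Q) (last Q)"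
    and inner: "\<And>L u v w R. Q = L @ [u, v, w] @ R \<Longrightarrow> v \<in> N \<Longrightarrow> u \<in> N \<or> w \<in> N"
    and k: "k \<in> set Q" "k \<in> N"
  obtains Q' where "set Q' = set Q" "distinct Q'" "successively E Q'" "Q' \<noteq> []" "hd Q' = k"
    "last Q' \<in> N" "inner_steps Q' = inner_steps Q"
proof -
  from k obtain L R where LR: "Q = L @ k # R" by (meson split_list)
  show ?thesis
  proof (cases "L = [] \<or> R = []")
    case True
    then show ?thesis
    proof
      assume "L = []" then show ?thesis using that[of Q] Q LR by auto
    next
      assume "R = []"
      then have "last Q = k" using LR by simp
      then show ?thesis using that[of "rev Q"] Q by (simp add: hd_rev last_rev)
    qed
  next
    case False
    obtain L' u where L: "L = L' @ [u]" using False by (metis append_butlast_last_id)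
    obtain w R' where R: "R = w # R'" using False by (cases R) auto
    have ne: "hd Q \<noteq> last Q" using Q(1) LR False L R by (cases L') auto
    then have cl: "E (last Q) (hd Q)" using closed by (blast intro: sym)
    have "u \<in> N \<or> w \<in> N" using inner[of L' u k w R'] LR L R k by auto
    then show ?thesis
    proof
      assume u: "u \<in> N"
      show ?thesis
      proof (rule that[of "k # R @ L"])
        show "inner_steps (k # R @ L) = inner_steps Q"
          using Q u k False by (auto simp: LR L stepsimps)
      qed (use Q u k cl False in \<open>auto simp: LR L pathsimps\<close>)
    next
      assume w: "w \<in> N"
      have cl': "E (hd Q) (last Q)" using cl by (rule sym)
      have kL: "E k (last L)" "R' \<noteq> [] \<Longrightarrow> E (hd R') w"
        using False Q commute[of k "last L"] commute[of w "hd R'"] by (simp_all add: LR R pathsimps)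
      show ?thesis
      proof (rule that[of "rev (L @ [k]) @ rev R"])
        show "inner_steps (rev (L @ [k]) @ rev R) = inner_steps Q"
          using Q w k False by (auto simp: LR R stepsimps)
      qed (use Q w k cl' kL False in \<open>auto simp: LR R pathsimps\<close>)
    qed
  qed
qed

end

section \<open>Systems of three path pieces\<close>

locale unspanned = clique_closing +
  fixes a b :: 'a
  assumes unspanned: "\<not> spans a b p"
begin

text \<open>What remains of an \<open>(a, b)\<close>-path of the completion without
  \<open>x\<close>: an initial piece, a final piece and one piece to be fitted in between. Being
  adjacent to all of \<open>N\<close>, the vertex \<open>x\<close> can make any one
  junction.\<close>

definition three_pieces :: "'a list \<Rightarrow> 'a list \<Rightarrow> 'a list \<Rightarrow> bool" where
  "three_pieces P Q R \<longleftrightarrow> P \<noteq> [] \<and> Q \<noteq> [] \<and> R \<noteq> [] \<and>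
     successively E P \<and> successively E Q \<and> successively E R \<and>
     distinct (P @ Q @ R) \<and> set (P @ Q @ R) = W - {x} \<and> hd P = a \<and> last R = b \<and>
     last P \<in> N \<and> hd Q \<in> N \<and> last Q \<in> N \<and> hd R \<in> N"

lemma three_pieces_rev_middle: "three_pieces P Q R \<Longrightarrow> three_pieces P (rev Q) R"
  by (auto simp: three_pieces_def hd_rev last_rev)

text \<open>An edge at one junction would leave \<open>x\<close> free to make the other one, and the
  pieces would join to a spanning path.\<close>

lemma three_pieces_hd_middle:
  assumes "three_pieces P Q R"
  shows "\<not> E (last P) (hd Q)" "\<not> E (last Q) (hd R)"
proof -
  have W: "insert x (set (P @ Q @ R)) = W" "x \<notin> set (P @ Q @ R)"
    using assms x_in_W by (auto simp: three_pieces_def)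
  show "\<not> E (last P) (hd Q)"
    using unspanned[of "P @ Q @ [x] @ R"] assms W
    by (auto simp: three_pieces_def spans_def pathsimps)
  show "\<not> E (last Q) (hd R)"
    using unspanned[of "P @ [x] @ Q @ R"] assms W
    by (auto simp: three_pieces_def spans_def pathsimps)
qed

text \<open>Turning \<open>Q\<close> around gives all four non-adjacencies. The adjacencies follow
  because \<open>N\<close> has no three independent vertices.\<close>

lemma three_pieces_ends:
  assumes "three_pieces P Q R"
  shows "\<not> E (last P) (hd Q)" "\<not> E (last P) (last Q)" "\<not> E (hd Q) (hd R)" "\<not> E (last Q) (hd R)"
    and "E (last P) (hd R)" "hd Q = last Q \<or> E (hd Q) (last Q)"
proof -
  show *: "\<not> E (last P) (hd Q)" "\<not> E (last P) (last Q)" "\<not> E (hd Q) (hd R)" "\<not> E (last Q) (hd R)"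
    using three_pieces_hd_middle[OF assms]
      three_pieces_hd_middle[OF three_pieces_rev_middle[OF assms]] by (auto simp: hd_rev last_rev)
  have ne: "last P \<noteq> hd Q" "last P \<noteq> last Q" "last P \<noteq> hd R" "hd Q \<noteq> hd R"
    using assms unfolding three_pieces_def
    by (metis distinct_append disjoint_iff Un_iff set_append hd_in_set last_in_set)+
  have N: "last P \<in> N" "hd Q \<in> N" "last Q \<in> N" "hd R \<in> N"
    using assms by (auto simp: three_pieces_def)
  show "E (last P) (hd R)" using three_in_N[of "last P" "hd Q" "hd R"] N ne * by blast
  show "hd Q = last Q \<or> E (hd Q) (last Q)"
    using three_in_N[of "last P" "hd Q" "last Q"] N ne * by blast
qed

end

locale best_pieces = unspanned +
  fixes P Q R :: "'a list"
  assumes pieces: "three_pieces P Q R"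
    and best: "three_pieces P' Q' R' \<Longrightarrow>
      inner_steps P' + inner_steps Q' + inner_steps R' \<le> inner_steps P + inner_steps Q + inner_steps R"
begin

lemma nonempty [simp]: "P \<noteq> []" "Q \<noteq> []" "R \<noteq> []"
  and paths: "successively E P" "successively E Q" "successively E R"
  and distinct_pieces: "distinct P" "distinct Q" "distinct R"
    "set P \<inter> set Q = {}" "set P \<inter> set R = {}" "set Q \<inter> set R = {}"
  and set_pieces: "set P \<union> set Q \<union> set R = W - {x}"
  and hd_P [simp]: "hd P = a" and last_R [simp]: "last R = b"
  and ends_in_N [simp]: "last P \<in> N" "hd Q \<in> N" "last Q \<in> N" "hd R \<in> N"
  using pieces by (auto simp: three_pieces_def)

lemma W_eq: "W = insert x (set P \<union> set Q \<union> set R)"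
  and x_notin [simp]: "x \<notin> set P" "x \<notin> set Q" "x \<notin> set R"
  using set_pieces x_in_W by auto

lemma no_spanning:
  assumes "p \<noteq> []" "distinct p" "successively E p" "hd p = a" "last p = b"
    "set p = insert x (set P \<union> set Q \<union> set R)"
  shows False
proof -
  have "set p = W" by (rule trans[OF assms(6) W_eq[symmetric]])
  then show False using assms(1-5) unspanned[of p] by (simp add: spans_def)
qed

lemmas ends_adj = three_pieces_ends[OF pieces]

text \<open>Reading all pieces backwards exchanges \<open>a\<close> with \<open>b\<close> and
  \<open>P\<close> with \<open>R\<close>. Interpreting the locale this way yields the mirror image
  of every lemma.\<close>

lemma flip: "best_pieces E x W b a (rev R) (rev Q) (rev P)"
proof -
  interpret r: unspanned E x W b a
    using unspanned spans_rev by unfold_locales blast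
  have eq: "three_pieces P' Q' R' \<longleftrightarrow> r.three_pieces (rev R') (rev Q') (rev P')" for P' Q' R'
    by (auto simp: three_pieces_def r.three_pieces_def hd_rev last_rev)
  show ?thesis
  proof unfold_locales
    show "r.three_pieces (rev R) (rev Q) (rev P)" using eq pieces by blast
    fix P' Q' R' assume "r.three_pieces P' Q' R'"
    then have "three_pieces (rev R') (rev Q') (rev P')" using eq by simp
    from best[OF this]
    show "inner_steps P' + inner_steps Q' + inner_steps R'
      \<le> inner_steps (rev R) + inner_steps (rev Q) + inner_steps (rev P)" by simp
  qed
qed

lemma other_bestI:
  assumes "three_pieces P' Q' R'"
    "inner_steps P' + inner_steps Q' + inner_steps R' = inner_steps P + inner_steps Q + inner_steps R"
  shows "best_pieces E x W a b P' Q' R'"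
  using assms best by unfold_locales auto

text \<open>A vertex of \<open>N\<close> with both neighbours on its piece outside \<open>N\<close> could be cut out of that
  piece and appended to an end of some piece, which would gain an inner step.\<close>

lemma inner_P:
  assumes P: "P = A @ [u, v, w] @ B" and v: "v \<in> N"
  shows "u \<in> N \<or> w \<in> N"
proof (rule ccontr)
  assume "\<not> (u \<in> N \<or> w \<in> N)"
  then have uw: "u \<notin> N" "w \<notin> N" by auto
  have "E v u" "E v w" using paths(1) commute[of u v] by (auto simp: P pathsimps)
  then have uw': "E u w" using outer_nbrs[of v u w] uw v x_notin(1) distinct_pieces(1)
    by (auto simp: P)
  have B: "B \<noteq> []" using ends_in_N(1) uw by (auto simp: P)
  have v_ne: "v \<noteq> last P" "v \<noteq> hd Q" using distinct_pieces B nonempty(2) hd_in_set[of Q]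
    by (auto simp: P)
  \<comment> \<open>\<open>last P\<close> and \<open>hd Q\<close> are not adjacent, so
    \<open>v\<close> is adjacent to one of them and can be attached there; the edge
    \<open>u w\<close> closes the gap that it leaves.\<close>
  then have "E (last P) v \<or> E v (hd Q)"
    using three_in_N[of "last P" v "hd Q"] ends_adj v distinct_pieces(4) nonempty
    by (metis ends_in_N(1,2) disjoint_iff hd_in_set last_in_set)
  then show False
  proof
    assume "E (last P) v"
    then have "three_pieces ((A @ [u, w] @ B) @ [v]) Q R"
      using pieces uw' v B by (auto simp: P three_pieces_def pathsimps)
    from best[OF this] show False using uw v B ends_in_N(1) by (auto simp: P stepsimps)
  next
    assume "E v (hd Q)"
    then have "three_pieces (A @ [u, w] @ B) (v # Q) R"
      using pieces uw' v B by (auto simp: P three_pieces_def pathsimps)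
    from best[OF this] show False using uw v B ends_in_N(2) by (auto simp: P stepsimps)
  qed
qed

lemma inner_R:
  assumes R: "R = A @ [u, v, w] @ B" and v: "v \<in> N"
  shows "u \<in> N \<or> w \<in> N"
proof -
  interpret r: best_pieces E x W b a "rev R" "rev Q" "rev P" by (rule flip)
  show ?thesis using r.inner_P[of "rev B" w v u "rev A"] assms by auto
qed

lemma inner_Q:
  assumes Q: "Q = A @ [u, v, w] @ B" and v: "v \<in> N"
  shows "u \<in> N \<or> w \<in> N"
proof (rule ccontr)
  assume "\<not> (u \<in> N \<or> w \<in> N)"
  then have uw: "u \<notin> N" "w \<notin> N" by auto
  have "E v u" "E v w" using paths(2) commute[of u v] by (auto simp: Q pathsimps)
  then have uw': "E u w" using outer_nbrs[of v u w] uw v x_notin(2) distinct_pieces(2)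
    by (auto simp: Q)
  have B: "B \<noteq> []" using ends_in_N(3) uw by (auto simp: Q)
  have A: "A \<noteq> []" using ends_in_N(2) uw by (auto simp: Q)
  have v_ne: "v \<noteq> last P" "v \<noteq> hd Q" using distinct_pieces A nonempty(1) last_in_set[of P]
    by (auto simp: Q)
  then have "E (last P) v \<or> E v (hd Q)"
    using three_in_N[of "last P" v "hd Q"] ends_adj v distinct_pieces(4) nonempty
    by (metis ends_in_N(1,2) disjoint_iff hd_in_set last_in_set)
  then show False
  proof
    assume "E (last P) v"
    then have "three_pieces (P @ [v]) (A @ [u, w] @ B) R"
      using pieces uw' v A B by (auto simp: Q three_pieces_def pathsimps)
    from best[OF this] show False using uw v B A ends_in_N(1) by (auto simp: Q stepsimps)
  next
    assume "E v (hd Q)"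
    then have "three_pieces P (v # A @ [u, w] @ B) R"
      using pieces uw' v A B by (auto simp: Q three_pieces_def pathsimps)
    from best[OF this] show False using uw v B A ends_in_N(2) by (auto simp: Q stepsimps)
  qed
qed

definition K :: "'a set" where "K = set Q \<inter> N"

text \<open>By the cycle argument every vertex of \<open>K\<close> can become the first vertex of
  \<open>Q\<close> in an equally good system. What is shown for \<open>hd Q\<close> thus carries
  over to all of \<open>K\<close>.\<close>

lemma K_reorder:
  assumes "k \<in> K"
  obtains Q' where "best_pieces E x W a b P Q' R" "hd Q' = k" "set Q' = set Q"
proof -
  have k: "k \<in> set Q" "k \<in> N" using assms by (auto simp: K_def)
  obtain Q' where Q': "set Q' = set Q" "distinct Q'" "successively E Q'" "Q' \<noteq> []" "hd Q' = k"
    "last Q' \<in> N" "inner_steps Q' = inner_steps Q"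
    by (rule reorder_from[OF distinct_pieces(2) paths(2) nonempty(2) ends_in_N(2,3) ends_adj(6) inner_Q k])
  have "best_pieces E x W a b P Q' R"
  proof (rule other_bestI)
    show "three_pieces P Q' R" using pieces Q' k by (auto simp: three_pieces_def)
  qed (use Q' in simp)
  then show thesis using that Q' by blast
qed

lemma ends_notin [simp]: "last P \<notin> set Q" "last P \<notin> set R" "hd R \<notin> set P" "hd R \<notin> set Q"
    "b \<notin> set P" "b \<notin> set Q" "a \<notin> set Q" "a \<notin> set R"
proof -
  have "last P \<in> set P" "hd R \<in> set R" "b \<in> set R" "a \<in> set P"
    using hd_in_set[of P] last_in_set[of R] by simp_all
  then show "last P \<notin> set Q" "last P \<notin> set R" "hd R \<notin> set P" "hd R \<notin> set Q"
    "b \<notin> set P" "b \<notin> set Q" "a \<notin> set Q" "a \<notin> set R"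
    using distinct_pieces by blast+
qed

lemma a_neq_b: "a \<noteq> b"
  using ends_notin(8) last_in_set[of R] by force

lemma K_nonadj:
  assumes "k \<in> K"
  shows "\<not> E k (last P)" "\<not> E k (hd R)" "\<not> E (last P) k" "\<not> E (hd R) k"
proof -
  obtain Q' where Q': "best_pieces E x W a b P Q' R" "hd Q' = k"
    using K_reorder[OF assms] .
  interpret q: best_pieces E x W a b P Q' R by fact
  show "\<not> E k (last P)" "\<not> E k (hd R)" "\<not> E (last P) k" "\<not> E (hd R) k"
    using q.ends_adj(1,3) Q'(2) sym by blast+
qed

lemma K_clique: "k \<in> K \<Longrightarrow> k' \<in> K \<Longrightarrow> k \<noteq> k' \<Longrightarrow> E k k'"
  using three_in_N[of k k' "last P"] K_nonadj ends_notin(1) unfolding K_def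
  by (metis IntE ends_in_N(1))

lemma K_nonempty: "hd Q \<in> K" "last Q \<in> K"
  by (auto simp: K_def)

text \<open>If the successor \<open>w\<close> of \<open>v\<close> is in \<open>N\<close>, then
  \<open>Q\<close> followed by \<open>x\<close> fits between \<open>v\<close> and \<open>w\<close>.
  If \<open>w\<close> is not in \<open>N\<close> but \<open>v\<close> has a predecessor
  \<open>u\<close>, then \<open>inner_P\<close> puts \<open>u\<close> into \<open>N\<close>, and
  \<open>x\<close> followed by the reverse of \<open>Q\<close> fits between \<open>u\<close> and
  \<open>v\<close>. The edge from \<open>last P\<close> to \<open>hd R\<close> completes both
  paths.\<close>

lemma nbr_hd_Q_in_P:
  assumes v: "v \<in> set P" "v \<in> N" and adj: "E v (hd Q)"
  shows "v = a" "P = A @ v # w # B \<Longrightarrow> w \<notin> N"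
proof -
  have adj': "E (hd Q) v" using adj by (rule sym)
  have succ: False if P: "P = A @ v # w # B" and w: "w \<in> N" for A w B
  proof (rule no_spanning[of "A @ [v] @ Q @ [x] @ (w # B) @ R"])
    show "successively E (A @ [v] @ Q @ [x] @ (w # B) @ R)"
      using paths adj w ends_adj(5) by (auto simp: P pathsimps)
    show "hd (A @ [v] @ Q @ [x] @ (w # B) @ R) = a" using hd_P by (cases A) (simp_all add: P)
  qed (use distinct_pieces x_notin in \<open>auto simp: P\<close>)
  show "w \<notin> N" if "P = A @ v # w # B" using succ that by blast
  show "v = a"
  proof (rule ccontr)
    assume "v \<noteq> a"
    from v obtain A B where P: "P = A @ v # B" by (meson split_list)
    have "A \<noteq> []" using \<open>v \<noteq> a\<close> hd_P by (auto simp: P)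
    then obtain A' u where A: "A = A' @ [u]" by (metis append_butlast_last_id)
    have "B \<noteq> []" using adj ends_adj(1) by (auto simp: P)
    then obtain w B' where B: "B = w # B'" by (cases B) auto
    have "w \<notin> N" using succ P B by blast
    then have u: "u \<in> N" using inner_P[of A' u v w B'] v P A B by auto
    have e: "successively E (v # w # B')" "successively E (A' @ [u])"
      using paths(1) by (simp_all add: P A B pathsimps)
    show False
    proof (rule no_spanning[of "(A' @ [u]) @ [x] @ rev Q @ (v # w # B') @ R"])
      show "successively E ((A' @ [u]) @ [x] @ rev Q @ (v # w # B') @ R)"
        using paths(2,3) e adj' u ends_adj(5) ends_in_N(1) by (auto simp: P A B pathsimps)
      show "hd ((A' @ [u]) @ [x] @ rev Q @ (v # w # B') @ R) = a"
        using hd_P by (cases A') (simp_all add: P A B)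
    qed (use distinct_pieces x_notin in \<open>auto simp: P A B\<close>)
  qed
qed

lemma nbr_K_in_P:
  assumes "v \<in> set P" "v \<in> N" "k \<in> K" "E v k"
  shows "v = a" "P = A @ v # w # B \<Longrightarrow> w \<notin> N"
proof -
  obtain Q' where Q': "best_pieces E x W a b P Q' R" "hd Q' = k"
    using K_reorder[OF assms(3)] .
  interpret q: best_pieces E x W a b P Q' R by fact
  show "v = a" "P = A @ v # w # B \<Longrightarrow> w \<notin> N"
    using q.nbr_hd_Q_in_P[of v] assms Q'(2) by auto
qed

end

section \<open>Structure of a neighbourhood without cut vertex\<close>

locale best_pieces_2conn = best_pieces +
  assumes conn: "U \<union> V = N - {c} \<Longrightarrow> U \<inter> V = {} \<Longrightarrow> U \<noteq> {} \<Longrightarrow> V \<noteq> {} \<Longrightarrow> \<exists>u\<in>U. \<exists>v\<in>V. E u v"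
begin

lemma flip_2conn: "best_pieces_2conn E x W b a (rev R) (rev Q) (rev P)"
  using flip conn unfolding best_pieces_2conn_def best_pieces_2conn_axioms_def by blast

text \<open>\<open>N - {a}\<close> is connected and contains \<open>hd R\<close>, so some edge in it
  leaves \<open>K\<close>. Its other end is not on \<open>P\<close>, where only \<open>a\<close> can
  be adjacent to \<open>K\<close>; by symmetry it can only be \<open>b\<close> on
  \<open>R\<close>.\<close>

lemma b_adj_K: "b \<in> N" "\<exists>k\<in>K. E b k"
proof -
  interpret r: best_pieces E x W b a "rev R" "rev Q" "rev P" by (rule flip)
  have rK: "r.K = K" by (simp add: K_def r.K_def)
  let ?V = "N - K - {a}"
  have aK: "a \<notin> K" by (simp add: K_def)
  have "hd R \<noteq> a" using ends_notin(8) by (metis hd_in_set nonempty(3))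
  then have "hd R \<in> ?V" by (simp add: K_def)
  moreover have "K \<union> ?V = N - {a}" using aK by (auto simp: K_def)
  ultimately obtain k v where kv: "k \<in> K" "v \<in> ?V" "E k v"
    using conn[of K ?V a] K_nonempty by blast
  have vk: "E v k" using kv(3) by (rule sym)
  have "v \<in> set P \<union> set R" using kv(2) N_sub_W set_pieces by (auto simp: K_def)
  moreover have "v \<notin> set P" using nbr_K_in_P(1)[of v k] kv vk by auto
  ultimately have "v = b" using r.nbr_K_in_P(1)[of v k] kv vk rK by auto
  then show "b \<in> N" "\<exists>k\<in>K. E b k" using kv vk by auto
qed

lemma a_adj_K: "a \<in> N" "\<exists>k\<in>K. E a k"
proof -
  interpret r: best_pieces_2conn E x W b a "rev R" "rev Q" "rev P" by (rule flip_2conn)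
  have rK: "r.K = K" by (simp add: K_def r.K_def)
  show "a \<in> N" "\<exists>k\<in>K. E a k" using r.b_adj_K rK by auto
qed

text \<open>Having a neighbour in \<open>K\<close>, the vertex \<open>a\<close> is not the end of
  \<open>P\<close>, and its successor lies outside \<open>N\<close> by \<open>nbr_K_in_P\<close>,
  whereas \<open>last P\<close> lies in \<open>N\<close>.\<close>

lemma P_split:
  obtains o1 P' where "P = a # o1 # P'" "o1 \<notin> N" "P' \<noteq> []"
proof -
  obtain k where k: "k \<in> K" "E a k" using a_adj_K by blast
  obtain P1 where P1: "P = a # P1" using hd_P by (cases P) auto
  have "a \<noteq> last P" using k K_nonadj by blast
  then obtain o1 P' where P: "P = a # o1 # P'" using P1 by (cases P1) auto
  have "o1 \<notin> N" using nbr_K_in_P(2)[of a k "[]" o1 P'] k a_adj_K P by auto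
  moreover have "P' \<noteq> []" using \<open>o1 \<notin> N\<close> ends_in_N(1) by (auto simp: P)
  ultimately show thesis using that P by blast
qed

text \<open>\<open>last P\<close> and \<open>last Q\<close> are not adjacent, so \<open>a\<close> is
  adjacent to one of them. In one case \<open>Q\<close> is traversed backwards from \<open>a\<close>
  and then left for \<open>o1\<close>; in the other the rest of \<open>P\<close> is traversed
  backwards down to \<open>o1\<close>, from where \<open>Q\<close> is entered.\<close>

lemma second_nonadj_hd_Q:
  assumes P: "P = a # o1 # P'" and o1: "o1 \<notin> N"
  shows "\<not> E o1 (hd Q)"
proof
  assume adj: "E o1 (hd Q)"
  then have adj': "E (hd Q) o1" by (rule sym)
  have e: "successively E (o1 # P')" using paths(1) by (simp add: P)
  have P'_ne: "P' \<noteq> []" using o1 ends_in_N(1) by (auto simp: P)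
  then have l: "last P' = last P" "last (o1 # P') = last P" by (simp_all add: P)
  from P'_ne have "last P \<noteq> a" using distinct_pieces(1) by (auto simp: P)
  then have "E a (last Q) \<or> E a (last P)"
    using three_in_N[of a "last P" "last Q"] a_adj_K(1) ends_adj(2) ends_notin(1,7) ends_in_N(1,3)
    by (metis last_in_set nonempty(2))
  then show False
  proof
    assume c: "E a (last Q)"
    show False
    proof (rule no_spanning[of "[a] @ rev Q @ (o1 # P') @ [x] @ R"])
      show "successively E ([a] @ rev Q @ (o1 # P') @ [x] @ R)"
        using paths(2,3) e c adj' l P'_ne ends_in_N(1,4) by (simp add: pathsimps)
    qed (use distinct_pieces x_notin in \<open>auto simp: P\<close>)
  next
    assume c: "E a (last P)"
    show False
    proof (rule no_spanning[of "[a] @ rev P' @ [o1] @ Q @ [x] @ R"])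
      have "E (hd P') o1" using e P'_ne sym by (auto simp: pathsimps)
      then show "successively E ([a] @ rev P' @ [o1] @ Q @ [x] @ R)"
        using paths(2,3) e P'_ne c adj l ends_in_N(3,4) by (simp add: pathsimps)
    qed (use distinct_pieces x_notin in \<open>auto simp: P\<close>)
  qed
qed

end

text \<open>Written without reference to pieces, so that the outcome speaks of the graph and of
  \<open>a\<close>, \<open>b\<close> only. For a best system \<open>near\<close> and
  \<open>far\<close> turn out to be \<open>K\<close> and \<open>A\<close>, by \<open>near_eq\<close>
  and \<open>far_eq\<close>.\<close>

definition near :: "('a \<Rightarrow> 'a \<Rightarrow> bool) \<Rightarrow> 'a \<Rightarrow> 'a \<Rightarrow> 'a \<Rightarrow> 'a set" where
  "near E x a b = {v. E x v \<and> v \<noteq> a \<and> v \<noteq> b \<and> E a v \<and> E b v}"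

definition far :: "('a \<Rightarrow> 'a \<Rightarrow> bool) \<Rightarrow> 'a \<Rightarrow> 'a \<Rightarrow> 'a \<Rightarrow> 'a set" where
  "far E x a b = {v. E x v \<and> v \<noteq> a \<and> v \<noteq> b \<and> \<not> (E a v \<and> E b v)}"

text \<open>The vertex \<open>z\<close> provides a clique through the edge \<open>a w\<close> that
  avoids \<open>x\<close>. Its not being adjacent to \<open>b\<close> will rule \<open>z\<close> out
  as an eligible vertex, since those are adjacent to both \<open>a\<close> and
  \<open>b\<close>.\<close>

definition link_far :: "('a \<Rightarrow> 'a \<Rightarrow> bool) \<Rightarrow> 'a \<Rightarrow> 'a \<Rightarrow> 'a \<Rightarrow> bool" where
  "link_far E x a b \<longleftrightarrow>
     (\<forall>w \<in> far E x a b. \<forall>w' \<in> far E x a b. E a w \<longrightarrow> E a w' \<longrightarrow> w = w') \<and>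
     (\<forall>w \<in> far E x a b. E a w \<longrightarrow> (\<exists>z. z \<noteq> x \<and> \<not> E x z \<and> E a z \<and> E w z \<and> \<not> E b z))"

text \<open>The interface between the path arguments and the clique cover. The near vertex and the
  second far vertex that it promises serve as third vertices of triangles there.\<close>

definition split_nbhd :: "('a \<Rightarrow> 'a \<Rightarrow> bool) \<Rightarrow> 'a \<Rightarrow> 'a \<Rightarrow> 'a \<Rightarrow> bool" where
  "split_nbhd E x a b \<longleftrightarrow> E x a \<and> E x b \<and> a \<noteq> b \<and>
     (\<forall>u \<in> near E x a b. \<forall>v \<in> near E x a b. u \<noteq> v \<longrightarrow> E u v) \<and>
     (\<forall>u \<in> far E x a b. \<forall>v \<in> far E x a b. u \<noteq> v \<longrightarrow> E u v) \<and>
     (\<forall>u \<in> near E x a b. \<forall>v \<in> far E x a b. \<not> E u v) \<and>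
     near E x a b \<noteq> {} \<and> (\<exists>u \<in> far E x a b. \<exists>v \<in> far E x a b. u \<noteq> v) \<and>
     link_far E x a b \<and> link_far E x b a"

context best_pieces_2conn
begin

lemma other_best_2connI:
  assumes "three_pieces P' Q' R'"
    "inner_steps P' + inner_steps Q' + inner_steps R' = inner_steps P + inner_steps Q + inner_steps R"
  shows "best_pieces_2conn E x W a b P' Q' R'"
  using other_bestI[OF assms] conn unfolding best_pieces_2conn_def best_pieces_2conn_axioms_def by blast

lemma K_reorder_2conn:
  assumes "k \<in> K"
  obtains Q' where "best_pieces_2conn E x W a b P Q' R" "hd Q' = k" "set Q' = set Q"
  using K_reorder[OF assms] conn
  unfolding best_pieces_2conn_def best_pieces_2conn_axioms_def by blast

lemma second_nonadj_K:
  assumes "P = a # P1" "P1 \<noteq> []" "hd P1 \<notin> N" "k \<in> K"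
  shows "\<not> E (hd P1) k"
proof -
  obtain Q' where Q': "best_pieces_2conn E x W a b P Q' R" "hd Q' = k"
    using K_reorder_2conn[OF assms(4)] .
  interpret q: best_pieces_2conn E x W a b P Q' R by fact
  show ?thesis using q.second_nonadj_hd_Q[of "hd P1" "tl P1"] assms Q'(2) by simp
qed

definition A :: "'a set" where "A = N - K - {a, b}"

text \<open>\<open>w\<close> lies on \<open>P\<close> or \<open>R\<close>, where only
  \<open>a\<close> and \<open>b\<close> can be adjacent to \<open>K\<close>.\<close>

lemma A_nonadj_K:
  assumes "w \<in> A" "k \<in> K" shows "\<not> E w k" "\<not> E k w"
proof -
  interpret r: best_pieces E x W b a "rev R" "rev Q" "rev P" by (rule flip)
  have rK: "r.K = K" by (simp add: K_def r.K_def)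
  have w: "w \<in> N" "w \<notin> K" "w \<noteq> a" "w \<noteq> b" using assms by (auto simp: A_def)
  have "w \<in> set P \<or> w \<in> set R" using w N_sub_W set_pieces by (auto simp: K_def)
  then show *: "\<not> E w k"
    using nbr_K_in_P(1)[of w k] r.nbr_K_in_P(1)[of w k] w rK assms by auto
  show "\<not> E k w" using * sym by blast
qed

lemma A_clique: "w \<in> A \<Longrightarrow> w' \<in> A \<Longrightarrow> w \<noteq> w' \<Longrightarrow> E w w'"
  using three_in_N[of w w' "hd Q"] A_nonadj_K[OF _ K_nonempty(1)] K_nonempty(1)
  by (metis A_def DiffD1 DiffD2 ends_in_N(2))

lemma ends_in_A: "last P \<in> A" "hd R \<in> A"
proof -
  obtain ka where ka: "ka \<in> K" "E a ka" using a_adj_K(2) by blast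
  obtain kb where kb: "kb \<in> K" "E b kb" using b_adj_K(2) by blast
  have "last P \<noteq> a" "hd R \<noteq> b" using ka kb K_nonadj(3,4) by metis+
  moreover have "last P \<noteq> b" "hd R \<noteq> a" using ends_notin(5,8) by (metis last_in_set nonempty(1), metis hd_in_set nonempty(3))
  ultimately show "last P \<in> A" "hd R \<in> A" by (simp_all add: A_def K_def)
qed

lemma second_P:
  obtains P1 where "P = a # P1" "P1 \<noteq> []" "hd P1 \<notin> N" "last P1 = last P"
  using P_split by (metis last_ConsR list.discI list.sel(1))

text \<open>Among the neighbours \<open>hd P1\<close>, \<open>w\<close> and \<open>k\<close> of
  \<open>a\<close>, with \<open>k\<close> in \<open>K\<close>, the vertex \<open>k\<close> is
  adjacent to neither of the others; no claw at \<open>a\<close> leaves only the edge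
  claimed.\<close>

lemma second_adj_far:
  assumes P: "P = a # P1" "P1 \<noteq> []" "hd P1 \<notin> N" and w: "w \<in> A" "E a w"
  shows "E (hd P1) w" "E w (hd P1)"
proof -
  obtain k where k: "k \<in> K" "E a k" using a_adj_K(2) by blast
  have "E a (hd P1)" using paths(1) P by (simp add: pathsimps)
  then have "E (hd P1) k \<or> E (hd P1) w \<or> E k w"
    using no_claw[of a "hd P1" k w] k w P(3) by (auto simp: A_def K_def)
  then show "E (hd P1) w" using second_nonadj_K[OF P k(1)] A_nonadj_K w k by blast
  then show "E w (hd P1)" by (rule sym)
qed

text \<open>From \<open>a\<close> the path can go directly through \<open>Q\<close> to
  \<open>x\<close>, which frees the rest of \<open>P\<close> to be placed next to \<open>w\<close>,
  as its first vertex is adjacent to \<open>w\<close>. If \<open>w\<close> lay on \<open>R\<close>,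
  this would exclude \<open>w = hd R\<close> and put both neighbours of \<open>w\<close> on
  \<open>R\<close> outside \<open>N\<close>, against \<open>inner_R\<close>. The same rerouting on
  \<open>P\<close> excludes a predecessor in \<open>N\<close>.\<close>

lemma far_nbr_of_a_aux:
  assumes aQ: "E a (hd Q)" and w: "w \<in> A" "E a w"
  shows "w \<in> set P" "P = C @ u # w # D \<Longrightarrow> u \<notin> N"
proof -
  interpret r: best_pieces_2conn E x W b a "rev R" "rev Q" "rev P" by (rule flip_2conn)
  have rK: "r.K = K" by (simp add: K_def r.K_def)
  obtain P1 where P1: "P = a # P1" "P1 \<noteq> []" "hd P1 \<notin> N" "last P1 = last P" by (rule second_P)
  have o1w: "E (hd P1) w" "E w (hd P1)" using second_adj_far[OF P1(1-3) w] by auto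
  have pP1: "successively E P1" using paths(1) P1 by (simp add: pathsimps)
  have lP1: "last P1 \<in> N" using P1(4) ends_in_N(1) by metis
  have RP: "E (hd R) (last P)" using ends_adj(5) by (rule sym)
  have wN: "w \<in> N" "w \<noteq> a" "w \<noteq> b" "w \<notin> K" using w by (auto simp: A_def)
  show "w \<in> set P"
  proof (rule ccontr)
    assume "w \<notin> set P"
    then have "w \<in> set R" using wN N_sub_W set_pieces by (auto simp: K_def)
    then obtain L M where R: "R = L @ w # M" by (meson split_list)
    have M: "M \<noteq> []" using wN(3) last_R by (auto simp: R)
    then obtain m M' where m: "M = m # M'" by (cases M) auto
    have L_nonempty: "L \<noteq> []"
    proof
      assume L: "L = []"
      show False
      proof (rule no_spanning[of "[a] @ Q @ [x] @ rev P1 @ R"])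
        show "successively E ([a] @ Q @ [x] @ rev P1 @ R)"
          using paths(2,3) pP1 P1 lP1 o1w aQ L R by (simp add: pathsimps)
      qed (use distinct_pieces x_notin P1 in auto)
    qed
    then obtain L' u where L: "L = L' @ [u]" by (metis append_butlast_last_id)
    have pR: "successively E L" "successively E (w # M)" "successively E M" "E (last L) w"
      using paths(3) R L_nonempty M by (auto simp: pathsimps)
    have hL: "hd L = hd R" using R L_nonempty by simp
    have lM: "last M = b" using last_R R M by simp
    have lu: "last L = u" using L by simp
    have "u \<notin> N"
    proof
      assume u: "u \<in> N"
      show False
      proof (rule no_spanning[of "[a] @ Q @ [x] @ rev L @ rev P1 @ [w] @ M"])
        show "successively E ([a] @ Q @ [x] @ rev L @ rev P1 @ [w] @ M)"
          using paths(2) pR pP1 P1 o1w aQ L_nonempty hL RP u lu M by (simp add: pathsimps)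
      qed (use distinct_pieces x_notin P1 R lM M in auto)
    qed
    moreover have "m \<notin> N"
    proof
      assume mN: "m \<in> N"
      obtain kb where kb: "kb \<in> K" "E b kb" using b_adj_K(2) by blast
      \<comment> \<open>Since \<open>b\<close> has a neighbour in \<open>K\<close>, the vertex
        before \<open>b\<close> on \<open>R\<close> lies outside \<open>N\<close>, by the mirror
        image of \<open>nbr_K_in_P\<close>; but \<open>w\<close> lies in \<open>N\<close>.\<close>
      have "m \<noteq> b"
      proof
        assume "m = b"
        then have "M' = []" using distinct_pieces(3) lM R m
          by (metis append_is_Nil_conv distinct.simps(2) distinct_append last_ConsR last_in_set)
        then have "rev R = [] @ b # w # rev L" using R m \<open>m = b\<close> by simp
        then have "w \<notin> N" using r.nbr_K_in_P(2)[of b kb "[]" w "rev L"] kb b_adj_K(1) rK last_in_set[of R]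
          by simp
        then show False using wN by simp
      qed
      moreover have "m \<in> set R" using R m by simp
      then have "m \<noteq> a" "m \<notin> K" "m \<noteq> last P" using ends_notin distinct_pieces by (auto simp: K_def)
      ultimately have "m \<in> A" using mN by (simp add: A_def)
      then have lPm: "E (last P) m" using A_clique ends_in_A(1) \<open>m \<noteq> last P\<close> by blast
      have hLx: "hd L \<in> N" using hL by simp
      show False
      proof (rule no_spanning[of "[a] @ Q @ [x] @ L @ [w] @ P1 @ M"])
        show "successively E ([a] @ Q @ [x] @ L @ [w] @ P1 @ M)"
          using paths(2) pR pP1 P1 o1w aQ L_nonempty hLx lPm m by (simp add: pathsimps)
      qed (use distinct_pieces x_notin P1 R lM M in auto)
    qed
    ultimately show False using inner_R[of L' u w m M'] R L m wN by auto
  qed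
  show "u \<notin> N" if PC: "P = C @ u # w # D"
  proof
    assume u: "u \<in> N"
    have "C \<noteq> []"
    proof
      assume "C = []"
      then have "hd P1 = w" using PC P1(1) by simp
      then show False using P1(3) wN by simp
    qed
    then obtain C' where C: "C = a # C'" using PC P1(1) by (cases C) auto
    have P1C: "P1 = (C' @ [u]) @ w # D" using PC C P1(1) by simp
    have h: "hd (C' @ [u]) = hd P1" using P1C by (cases C') auto
    have p: "successively E (C' @ [u])" "successively E (w # D)" "last (w # D) = last P"
      using pP1 P1(4) unfolding P1C by (simp_all only: successively_append_iff, simp)
    have e: "E (hd (C' @ [u])) w" "E (last (w # D)) (hd R)"
      unfolding h p(3) using o1w ends_adj(5) by simp_all
    show False
    proof (rule no_spanning[of "[a] @ Q @ [x] @ rev (C' @ [u]) @ (w # D) @ R"])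
      show "successively E ([a] @ Q @ [x] @ rev (C' @ [u]) @ (w # D) @ R)"
        using paths(2,3) p(1,2) e aQ u by (cases "D = []") (simp_all add: pathsimps del: rev_append)
    qed (use distinct_pieces x_notin P1(1) P1C in auto)
  qed
qed

lemma far_nbr_of_a:
  assumes w: "w \<in> A" "E a w"
  shows "w \<in> set P" "P = C @ u # w # D \<Longrightarrow> u \<notin> N"
proof -
  obtain k where k: "k \<in> K" "E a k" using a_adj_K(2) by blast
  obtain Q' where Q': "best_pieces_2conn E x W a b P Q' R" "hd Q' = k" "set Q' = set Q"
    using K_reorder_2conn[OF k(1)] .
  interpret q: best_pieces_2conn E x W a b P Q' R by fact
  have "q.A = A" by (simp add: A_def q.A_def K_def q.K_def Q'(3))
  then show "w \<in> set P" "P = C @ u # w # D \<Longrightarrow> u \<notin> N"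
    using q.far_nbr_of_a_aux[of w] k w Q'(2) by auto
qed

text \<open>\<open>hd R\<close> is in \<open>A\<close> but not on \<open>P\<close>, so it is not
  adjacent to \<open>a\<close>; nor is it adjacent to \<open>k\<close>. Three vertices of
  \<open>N\<close> then leave only the edge \<open>a k\<close>.\<close>

lemma a_adj_all_K: "k \<in> K \<Longrightarrow> E a k"
proof -
  assume k: "k \<in> K"
  have "\<not> E a (hd R)" using far_nbr_of_a(1)[of "hd R"] ends_in_A(2) by auto
  moreover have "a \<noteq> hd R" "k \<noteq> hd R"
    using ends_in_A(2) k by (auto simp: A_def)
  moreover have "a \<noteq> k" using k ends_notin(7) by (metis IntD1 K_def)
  ultimately show "E a k"
    using three_in_N[of a k "hd R"] K_nonadj(2)[OF k] k a_adj_K(1) by (auto simp: K_def)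
qed

text \<open>The predecessor of \<open>w\<close> is outside \<open>N\<close>, so its successor is
  inside, and \<open>D\<close> can be moved from \<open>P\<close> to the front of \<open>R\<close>.
  The inner step lost after \<open>w\<close> is made up by the one from \<open>last P\<close> to
  \<open>hd R\<close>, so the new system is again best; but \<open>w'\<close> has left its first
  piece.\<close>

lemma far_nbr_of_a_unique_aux:
  assumes w: "w \<in> A" "E a w" and w': "w' \<in> A" "E a w'" and P: "P = C @ w # D" "w' \<in> set D"
  shows False
proof -
  have C: "C \<noteq> []" using w hd_P P by (auto simp: A_def)
  then obtain C' u where C': "C = C' @ [u]" by (metis append_butlast_last_id)
  have u: "u \<notin> N" using far_nbr_of_a(2)[OF w, of C' u D] P C' by simp
  obtain d D' where D: "D = d # D'" using P(2) by (cases D) auto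
  have d: "d \<in> N" using inner_P[of C' u w d D'] P C' D u w by (auto simp: A_def)
  have wN: "w \<in> N" using w by (simp add: A_def)
  have lD: "D \<noteq> []" "hd D = d" "last D \<in> N"
    using P D ends_in_N(1) by simp_all
  interpret q: best_pieces_2conn E x W a b "C @ [w]" Q "D @ R"
  proof (rule other_best_2connI)
    show "three_pieces (C @ [w]) Q (D @ R)"
      using pieces P(1) C d wN lD ends_adj(5) by (auto simp: three_pieces_def pathsimps)
    show "inner_steps (C @ [w]) + inner_steps Q + inner_steps (D @ R) =
        inner_steps P + inner_steps Q + inner_steps R"
      using P(1) C d wN lD by (simp add: stepsimps)
  qed
  have "q.A = A" by (simp add: A_def q.A_def K_def q.K_def)
  then have "w' \<in> set (C @ [w])" using q.far_nbr_of_a(1)[of w'] w' by simp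
  then show False using distinct_pieces(1) P by auto
qed

lemma far_nbr_of_a_unique:
  assumes w: "w \<in> A" "E a w" and w': "w' \<in> A" "E a w'"
  shows "w = w'"
proof (rule ccontr)
  assume ne: "w \<noteq> w'"
  have "w \<in> set P" "w' \<in> set P" using far_nbr_of_a(1) w w' by auto
  then obtain C D where P: "P = C @ w # D" by (meson split_list)
  show False
  proof (cases "w' \<in> set D")
    case True
    then show False using far_nbr_of_a_unique_aux[OF w w' P] by blast
  next
    case False
    then have "w' \<in> set C" using P ne \<open>w' \<in> set P\<close> by auto
    then obtain C1 C2 where "C = C1 @ w' # C2" by (meson split_list)
    then show False using far_nbr_of_a_unique_aux[OF w' w, of C1 "C2 @ w # D"] P by auto
  qed
qed

lemma no_far_nbr_of_both:
  assumes "w \<in> A" shows "\<not> (E a w \<and> E b w)"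
proof
  interpret r: best_pieces_2conn E x W b a "rev R" "rev Q" "rev P" by (rule flip_2conn)
  have "r.A = A" by (auto simp: A_def r.A_def K_def r.K_def)
  moreover assume "E a w \<and> E b w"
  ultimately have "w \<in> set P" "w \<in> set R"
    using far_nbr_of_a(1)[of w] r.far_nbr_of_a(1)[of w] assms by auto
  then show False using distinct_pieces by blast
qed

text \<open>If adjacent to \<open>b\<close>, the second vertex of \<open>P\<close> would also be
  adjacent to the predecessor of \<open>b\<close> on \<open>R\<close>, both being neighbours of
  \<open>b\<close> outside \<open>N\<close>. That edge joins the reversed rest of \<open>P\<close>
  to the reversed rest of \<open>R\<close>, and \<open>hd R\<close> leads on to
  \<open>b\<close>.\<close>

lemma second_nonadj_b_aux:
  assumes P1: "P = a # P1" "P1 \<noteq> []" "hd P1 \<notin> N" "last P1 = last P"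
    and b: "E b (hd R)"
  shows "\<not> E (hd P1) b"
proof
  interpret r: best_pieces_2conn E x W b a "rev R" "rev Q" "rev P" by (rule flip_2conn)
  assume o1b: "E (hd P1) b"
  obtain R1 where R1: "rev R = b # R1" "R1 \<noteq> []" "hd R1 \<notin> N" "last R1 = last (rev R)"
    by (rule r.second_P)
  have R: "R = rev R1 @ [b]" using R1(1) by (metis rev.simps(2) rev_rev_ident)
  have bR1: "E b (hd R1)" using paths(3) R R1(2) commute[of b] by (simp add: pathsimps)
  have "hd P1 \<in> set P" "hd R1 \<in> set R" using P1 R R1(2) by auto
  then have "hd P1 \<noteq> hd R1" "hd P1 \<noteq> x" "hd R1 \<noteq> x"
    using distinct_pieces(5) x_notin(1,3) by (metis disjoint_iff)+
  then have oo: "E (hd P1) (hd R1)"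
    using outer_nbrs[of b "hd P1" "hd R1"] bR1 o1b P1(3) R1(3) b_adj_K(1) sym by blast
  have hR: "hd R = last R1" using R R1(2) by (simp add: hd_rev)
  have pP1: "successively E P1" using paths(1) P1 by (simp add: pathsimps)
  have pR1: "successively E R1" using paths(3) R by (simp add: pathsimps)
  have lb: "E (last R1) b" using b hR sym by simp
  have lP: "last P1 \<in> N" using P1(4) ends_in_N(1) by metis
  show False
  proof (rule no_spanning[of "[a] @ Q @ [x] @ rev P1 @ R1 @ [b]"])
    show "successively E ([a] @ Q @ [x] @ rev P1 @ R1 @ [b])"
      using paths(2) pP1 pR1 P1(2) R1(2) oo lb lP a_adj_all_K[OF K_nonempty(1)] by (simp add: pathsimps)
  qed (use distinct_pieces x_notin P1(1) R in auto)
qed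

text \<open>Connectedness of \<open>N - {a}\<close> gives \<open>b\<close> a neighbour
  \<open>w\<close> in \<open>A\<close>, which lies on \<open>R\<close>. Moving the part of
  \<open>R\<close> before \<open>w\<close> to the end of \<open>P\<close> gives a best system whose
  last piece starts at \<open>w\<close>, while the second vertex of the first piece is
  unchanged.\<close>

lemma second_nonadj_b:
  assumes P1: "P = a # P1" "P1 \<noteq> []" "hd P1 \<notin> N" "last P1 = last P"
  shows "\<not> E (hd P1) b"
proof -
  interpret r: best_pieces_2conn E x W b a "rev R" "rev Q" "rev P" by (rule flip_2conn)
  have rK: "r.K = K" "r.A = A" by (auto simp: K_def r.K_def A_def r.A_def)
  have "\<exists>u \<in> insert b K. \<exists>v \<in> A. E u v"
  proof (rule conn[where c = a])
    show "insert b K \<union> A = N - {a}" "insert b K \<inter> A = {}"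
      using b_adj_K(1) a_neq_b ends_notin(7) by (auto simp: A_def K_def)
  qed (use ends_in_A in auto)
  then obtain w where w: "w \<in> A" "E b w" using A_nonadj_K by blast
  have wN: "w \<in> N" "w \<noteq> b" using w by (auto simp: A_def)
  have "w \<in> set R" using r.far_nbr_of_a(1)[of w] rK w by simp
  then obtain L M where R: "R = L @ w # M" by (meson split_list)
  have M: "M \<noteq> []" using wN(2) last_R by (auto simp: R)
  then obtain m M' where m: "M = m # M'" by (cases M) auto
  have mN: "m \<notin> N" using r.far_nbr_of_a(2)[of w "rev M'" m "rev L"] w rK R m by simp
  show ?thesis
  proof (cases "L = []")
    case True
    then show ?thesis using second_nonadj_b_aux[OF P1] w R by simp
  next
    case False
    then obtain L' u where L: "L = L' @ [u]" by (metis append_butlast_last_id)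
    have uN: "u \<in> N" using inner_R[of L' u w m M'] R L m mN wN by auto
    have "hd L = hd R" using R False by simp
    then have hL: "hd L \<in> N" "E (last P) (hd L)" using ends_adj(5) by simp_all
    have lL: "last L = u" using L by simp
    interpret q: best_pieces_2conn E x W a b "P @ L" Q "w # M"
    proof (rule other_best_2connI)
      show "three_pieces (P @ L) Q (w # M)"
        using pieces R False uN wN hL lL ends_adj(5) by (auto simp: three_pieces_def pathsimps)
      show "inner_steps (P @ L) + inner_steps Q + inner_steps (w # M) =
          inner_steps P + inner_steps Q + inner_steps R"
        using R False hL lL uN wN M by (simp add: stepsimps)
    qed
    have "P @ L = a # (P1 @ L)" "P1 @ L \<noteq> []" "hd (P1 @ L) = hd P1" "last (P1 @ L) = last (P @ L)"
      using P1 False by simp_all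
    then show ?thesis using q.second_nonadj_b_aux[of "P1 @ L"] w P1(3) by simp
  qed
qed

lemma near_eq: "near E x a b = K"
proof -
  interpret r: best_pieces_2conn E x W b a "rev R" "rev Q" "rev P" by (rule flip_2conn)
  have rK: "r.K = K" by (simp add: K_def r.K_def)
  show ?thesis
    using no_far_nbr_of_both a_adj_all_K r.a_adj_all_K rK ends_notin(6,7)
    by (auto simp: near_def A_def K_def)
qed

lemma far_eq: "far E x a b = A"
proof -
  have "far E x a b = N - near E x a b - {a, b}" by (auto simp: near_def far_def)
  then show ?thesis by (simp add: near_eq A_def)
qed

text \<open>The witness \<open>z\<close> is the second vertex of \<open>P\<close>, whatever the far
  neighbour of \<open>a\<close>.\<close>

lemma link_far_a: "link_far E x a b"
proof -
  obtain P1 where P1: "P = a # P1" "P1 \<noteq> []" "hd P1 \<notin> N" "last P1 = last P" by (rule second_P)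
  have "E a (hd P1)" using paths(1) P1(1,2) by (simp add: pathsimps)
  moreover have "hd P1 \<noteq> x" using x_notin(1) P1(1,2) by auto
  moreover have "\<not> E b (hd P1)" using second_nonadj_b[OF P1] sym by blast
  ultimately show ?thesis
    using far_nbr_of_a_unique second_adj_far(2)[OF P1(1-3)] P1(3)
    unfolding link_far_def far_eq by (metis N_iff(1))
qed

lemma split_nbhd: "split_nbhd E x a b"
proof -
  interpret r: best_pieces_2conn E x W b a "rev R" "rev Q" "rev P" by (rule flip_2conn)
  \<comment> \<open>These are the two distinct far vertices that \<open>split_nbhd\<close> asks
    for.\<close>
  have "last P \<noteq> hd R" using ends_notin(2) by (metis hd_in_set nonempty(3))
  then show ?thesis
    using a_adj_K(1) b_adj_K(1) a_neq_b K_clique A_clique A_nonadj_K(2) K_nonempty(1) ends_in_A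
      link_far_a r.link_far_a
    unfolding split_nbhd_def near_eq far_eq by auto
qed

end

section \<open>Paths starting at the completed vertex\<close>

text \<open>The case of a path that starts at \<open>x\<close>: there is no initial piece, so two
  pieces suffice. Here no exceptional structure survives when \<open>N\<close> has no cut vertex,
  and the aim is a contradiction.\<close>

locale unspanned_centre = clique_closing +
  fixes b :: 'a
  assumes unspanned_centre: "\<not> spans x b p"
begin

definition two_pieces :: "'a list \<Rightarrow> 'a list \<Rightarrow> bool" where
  "two_pieces Q R \<longleftrightarrow> Q \<noteq> [] \<and> R \<noteq> [] \<and> successively E Q \<and> successively E R \<and>
     distinct (Q @ R) \<and> set (Q @ R) = W - {x} \<and> last R = b \<and>
     hd Q \<in> N \<and> last Q \<in> N \<and> hd R \<in> N"

end

locale best_two_pieces = unspanned_centre +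
  fixes Q R :: "'a list"
  assumes pieces: "two_pieces Q R"
    and best: "two_pieces Q' R' \<Longrightarrow> inner_steps Q' + inner_steps R' \<le> inner_steps Q + inner_steps R"
    and conn: "U \<union> V = N - {c} \<Longrightarrow> U \<inter> V = {} \<Longrightarrow> U \<noteq> {} \<Longrightarrow> V \<noteq> {} \<Longrightarrow> \<exists>u\<in>U. \<exists>v\<in>V. E u v"
begin

lemma nonempty [simp]: "Q \<noteq> []" "R \<noteq> []"
  and paths: "successively E Q" "successively E R"
  and distinct_pieces: "distinct Q" "distinct R" "set Q \<inter> set R = {}"
  and set_pieces: "set Q \<union> set R = W - {x}"
  and last_R [simp]: "last R = b"
  and ends_in_N [simp]: "hd Q \<in> N" "last Q \<in> N" "hd R \<in> N"
  using pieces by (auto simp: two_pieces_def)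

lemma W_eq: "W = insert x (set Q \<union> set R)"
  and x_notin [simp]: "x \<notin> set Q" "x \<notin> set R"
  using set_pieces x_in_W by auto

lemma no_spanning:
  assumes "p \<noteq> []" "distinct p" "successively E p" "hd p = x" "last p = b"
    "set p = insert x (set Q \<union> set R)"
  shows False
proof -
  have "set p = W" by (rule trans[OF assms(6) W_eq[symmetric]])
  then show False using assms(1-5) unspanned_centre[of p] by (simp add: spans_def)
qed

lemma hd_R_notin [simp]: "hd R \<notin> set Q"
  using distinct_pieces(3) by (metis disjoint_iff hd_in_set nonempty(2))

lemma ends_adj: "\<not> E (hd Q) (hd R)" "\<not> E (last Q) (hd R)" "hd Q = last Q \<or> E (hd Q) (last Q)"
proof -
  show *: "\<not> E (last Q) (hd R)"
  proof
    assume "E (last Q) (hd R)"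
    then show False
      using no_spanning[of "[x] @ Q @ R"] paths distinct_pieces x_notin by (simp add: pathsimps)
  qed
  show **: "\<not> E (hd Q) (hd R)"
  proof
    assume "E (hd Q) (hd R)"
    then show False
      using no_spanning[of "[x] @ rev Q @ R"] paths distinct_pieces x_notin by (simp add: pathsimps)
  qed
  have "hd Q \<noteq> hd R" "last Q \<noteq> hd R" using hd_R_notin by (metis hd_in_set nonempty(1), metis last_in_set nonempty(1))
  then show "hd Q = last Q \<or> E (hd Q) (last Q)"
    using three_in_N[of "hd Q" "last Q" "hd R"] * ** by auto
qed

lemma adj_hd_R_or_hd_Q:
  assumes "v \<in> N" "v \<noteq> hd R" "v \<noteq> hd Q"
  shows "E v (hd R) \<or> E v (hd Q)"
proof -
  have "hd Q \<noteq> hd R" using hd_R_notin by (metis hd_in_set nonempty(1))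
  then show ?thesis using three_in_N[of v "hd R" "hd Q"] ends_adj(1) assms sym by auto
qed

text \<open>As for three pieces: a vertex that can be bypassed is put in front of \<open>Q\<close>
  or \<open>R\<close>, which gains an inner step.\<close>

lemma inner_R:
  assumes R: "R = A @ [u, v, w] @ B" and v: "v \<in> N"
  shows "u \<in> N \<or> w \<in> N"
proof (rule ccontr)
  assume "\<not> (u \<in> N \<or> w \<in> N)"
  then have uw: "u \<notin> N" "w \<notin> N" by auto
  have "E v u" "E v w" using paths(2) commute[of u v] by (auto simp: R pathsimps)
  then have uw': "E u w" using outer_nbrs[of v u w] uw v x_notin(2) distinct_pieces(2)
    by (auto simp: R)
  have A: "A \<noteq> []" using ends_in_N(3) uw by (auto simp: R)
  have "v \<noteq> hd R" "v \<noteq> hd Q" using distinct_pieces A hd_in_set[of Q] by (auto simp: R)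
  then have "E v (hd R) \<or> E v (hd Q)" by (rule adj_hd_R_or_hd_Q[OF v])
  then show False
  proof
    assume "E v (hd R)"
    then have "two_pieces Q (v # A @ [u, w] @ B)"
      using pieces uw' v A by (auto simp: R two_pieces_def pathsimps)
    from best[OF this] show False using uw v A ends_in_N(3) by (auto simp: R stepsimps)
  next
    assume "E v (hd Q)"
    then have "two_pieces (v # Q) (A @ [u, w] @ B)"
      using pieces uw' v A by (auto simp: R two_pieces_def pathsimps)
    from best[OF this] show False using uw v A ends_in_N(1) by (auto simp: R stepsimps)
  qed
qed

lemma inner_Q:
  assumes Q: "Q = A @ [u, v, w] @ B" and v: "v \<in> N"
  shows "u \<in> N \<or> w \<in> N"
proof (rule ccontr)
  assume "\<not> (u \<in> N \<or> w \<in> N)"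
  then have uw: "u \<notin> N" "w \<notin> N" by auto
  have "E v u" "E v w" using paths(1) commute[of u v] by (auto simp: Q pathsimps)
  then have uw': "E u w" using outer_nbrs[of v u w] uw v x_notin(1) distinct_pieces(1)
    by (auto simp: Q)
  have A: "A \<noteq> []" using ends_in_N(1) uw by (auto simp: Q)
  have B: "B \<noteq> []" using ends_in_N(2) uw by (auto simp: Q)
  have "v \<noteq> hd R" "v \<noteq> hd Q" using distinct_pieces A hd_R_notin by (auto simp: Q)
  then have "E v (hd R) \<or> E v (hd Q)" by (rule adj_hd_R_or_hd_Q[OF v])
  then show False
  proof
    assume "E v (hd R)"
    then have "two_pieces (A @ [u, w] @ B) (v # R)"
      using pieces uw' v A B by (auto simp: Q two_pieces_def pathsimps)
    from best[OF this] show False using uw v A B ends_in_N(3) by (auto simp: Q stepsimps)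
  next
    assume "E v (hd Q)"
    then have "two_pieces (v # A @ [u, w] @ B) R"
      using pieces uw' v A B by (auto simp: Q two_pieces_def pathsimps)
    from best[OF this] show False using uw v A B ends_in_N(1) by (auto simp: Q stepsimps)
  qed
qed

definition K :: "'a set" where "K = set Q \<inter> N"

lemma K_nonempty: "hd Q \<in> K" "last Q \<in> K"
  by (auto simp: K_def)

lemma K_reorder:
  assumes "k \<in> K"
  obtains Q' where "best_two_pieces E x W b Q' R" "hd Q' = k" "set Q' = set Q"
proof -
  have k: "k \<in> set Q" "k \<in> N" using assms by (auto simp: K_def)
  obtain Q' where Q': "set Q' = set Q" "distinct Q'" "successively E Q'" "Q' \<noteq> []" "hd Q' = k"
    "last Q' \<in> N" "inner_steps Q' = inner_steps Q"
    by (rule reorder_from[OF distinct_pieces(1) paths(1) nonempty(1) ends_in_N(1,2) ends_adj(3) inner_Q k])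
  have "two_pieces Q' R" using pieces Q' k by (auto simp: two_pieces_def)
  then have "best_two_pieces E x W b Q' R"
    using best conn Q'(7) by unfold_locales auto
  then show thesis using that Q' by blast
qed

lemma K_nonadj:
  assumes "k \<in> K" shows "\<not> E k (hd R)" "\<not> E (hd R) k"
proof -
  obtain Q' where Q': "best_two_pieces E x W b Q' R" "hd Q' = k" using K_reorder[OF assms] .
  interpret q: best_two_pieces E x W b Q' R by fact
  show "\<not> E k (hd R)" "\<not> E (hd R) k" using q.ends_adj(1) Q'(2) sym by blast+
qed

lemma N_minus_K: "v \<in> N \<Longrightarrow> v \<notin> K \<Longrightarrow> v \<in> set R"
  using N_sub_W set_pieces by (auto simp: K_def)

lemma set_R_notin_K: "v \<in> set R \<Longrightarrow> v \<notin> K"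
  using distinct_pieces(3) by (auto simp: K_def)

text \<open>\<open>last Q\<close> and \<open>hd R\<close> are not adjacent, so a successor
  \<open>w\<close> in \<open>N\<close> would be adjacent to one of them. Then either
  \<open>Q\<close> fits between \<open>v\<close> and \<open>w\<close>, or the path goes backwards
  through \<open>Q\<close>, on to \<open>v\<close>, and backwards through \<open>L\<close> to
  \<open>w\<close>.\<close>

lemma succ_of_nbr_hd_Q:
  assumes R: "R = L @ v # w # M" and v: "v \<in> N" and adj: "E v (hd Q)"
  shows "w \<notin> N"
proof
  assume w: "w \<in> N"
  have adj': "E (hd Q) v" using adj by (rule sym)
  have L: "L \<noteq> []" using adj' ends_adj(1) R by auto
  have hL: "hd L \<in> N" using ends_in_N(3) R L by simp
  have p: "successively E L" "E (last L) v" "E v (last L)" "E v w" "successively E (w # M)"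
    using paths(2) R L commute[of v "last L"] by (simp_all add: pathsimps)
  have lw: "last (w # M) = b" using last_R by (simp add: R)
  have "w \<noteq> hd R" using distinct_pieces(2) R L by (cases L) auto
  moreover have "w \<in> set R" using R by simp
  then have "w \<noteq> last Q" using distinct_pieces(3) by (metis disjoint_iff last_in_set nonempty(1))
  ultimately have "E w (last Q) \<or> E w (hd R)"
    using three_in_N[of w "last Q" "hd R"] w ends_adj(2) hd_R_notin
    by (metis ends_in_N(2,3) last_in_set nonempty(1))
  then show False
  proof
    assume "E w (last Q)"
    then have e: "E (last Q) w" by (rule sym)
    show False
    proof (rule no_spanning[of "[x] @ L @ [v] @ Q @ (w # M)"])
      show "successively E ([x] @ L @ [v] @ Q @ (w # M))"
        using e hL p L paths(1) adj by (auto simp: pathsimps)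
    qed (use distinct_pieces x_notin R lw in auto)
  next
    assume "E w (hd R)"
    then have e: "E (hd L) w" using R L sym by simp
    show False
    proof (rule no_spanning[of "[x] @ rev Q @ [v] @ rev L @ (w # M)"])
      show "successively E ([x] @ rev Q @ [v] @ rev L @ (w # M))"
        using e p L paths(1) adj' by (auto simp: pathsimps)
    qed (use distinct_pieces x_notin R lw in auto)
  qed
qed

lemma succ_of_nbr_K:
  assumes R: "R = L @ v # w # M" and v: "v \<in> N" and adj: "k \<in> K" "E v k"
  shows "w \<notin> N"
proof -
  obtain Q' where Q': "best_two_pieces E x W b Q' R" "hd Q' = k" using K_reorder[OF adj(1)] .
  interpret q: best_two_pieces E x W b Q' R by fact
  show ?thesis using q.succ_of_nbr_hd_Q[OF R v] adj Q'(2) by simp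
qed

text \<open>The successor of \<open>v\<close> is outside \<open>N\<close>, so by
  \<open>inner_R\<close> its predecessor is inside. A predecessor of \<open>v'\<close> inside
  \<open>N\<close> leads to a spanning path; once it is known to be outside, \<open>inner_R\<close>
  leaves no room for a successor of \<open>v'\<close>.\<close>

lemma two_nbrs_hd_Q:
  assumes R: "R = L @ v # M @ v' # S" and v: "v \<in> N" "v' \<in> N"
    and adj: "E v (hd Q)" "k \<in> K" "E v' k"
  shows "L \<noteq> []" "last L \<in> N" "M \<noteq> []" "hd M \<notin> N" "last M \<notin> N" "S = []"
proof -
  have adj': "E (hd Q) v" using adj(1) by (rule sym)
  show L: "L \<noteq> []" using adj' ends_adj(1) R by auto
  have hL: "hd L \<in> N" "hd L = hd R" using ends_in_N(3) R L by simp_all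
  show M: "M \<noteq> []" using succ_of_nbr_hd_Q[of L v v' S] R v adj by auto
  then obtain m M' where m: "M = m # M'" by (cases M) auto
  have hM: "m \<notin> N" using succ_of_nbr_hd_Q[of L v m "M' @ v' # S"] R m v adj by auto
  then show "hd M \<notin> N" by (simp add: m)
  obtain L' u where u: "L = L' @ [u]" using L by (metis append_butlast_last_id)
  have uN: "u \<in> N" using inner_R[of L' u v m "M' @ v' # S"] R u m v hM by auto
  then show lL: "last L \<in> N" by (simp add: u)
  obtain M'' y where y: "M = M'' @ [y]" using M by (metis append_butlast_last_id)
  have in_R: "u \<in> set R" "y \<in> set R" "v' \<in> set R" using R u y by auto
  show lM: "last M \<notin> N"
  proof
    assume "last M \<in> N"
    then have yN: "y \<in> N" by (simp add: y)
    \<comment> \<open>Both \<open>u\<close> and \<open>y\<close> are followed on \<open>R\<close> by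
      a vertex of \<open>N\<close>, so neither has a neighbour in \<open>K\<close>. Comparison with
      \<open>hd Q\<close> then forces the chords from \<open>y\<close> to \<open>u\<close> and to
      \<open>hd R\<close>.\<close>
    have uK: "\<not> E u k'" if "k' \<in> K" for k'
      using succ_of_nbr_K[of L' u v "M @ v' # S" k'] that R u uN v by auto
    have yK: "\<not> E y k'" if "k' \<in> K" for k'
      using succ_of_nbr_K[of "L @ v # M''" y v' S k'] that R y yN v by auto
    have ne: "y \<noteq> hd R" "y \<noteq> u" "v' \<noteq> hd R"
      using distinct_pieces(2) L unfolding R u y by (cases L'; auto)+
    have neQ: "y \<noteq> hd Q" "u \<noteq> hd Q" "v' \<noteq> last Q"
      using in_R distinct_pieces(3) by (metis disjoint_iff hd_in_set last_in_set nonempty(1))+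
    have "E y u" using three_in_N[of y u "hd Q"] uN yN neQ ne uK yK K_nonempty(1) by auto
    then have yu: "E (last M) (last L)" by (simp add: y u)
    have "E y (hd R)"
      using three_in_N[of y "hd R" "hd Q"] yN neQ ne yK K_nonempty(1) ends_adj(1) sym hd_R_notin
      by (metis ends_in_N(1,3) hd_in_set nonempty(1))
    then have yh: "E (hd L) (last M)" unfolding hL(2) using sym by (simp add: y)
    have p: "successively E L" "E v (hd M)" "E (hd M) v" "successively E M" "successively E (v' # S)"
      using paths(2) R L M commute[of v "hd M"] by (simp_all add: pathsimps)
    have lb: "last (v' # S) = b" using last_R by (simp add: R)
    have "E v' (hd R) \<or> E v' (last Q)"
      using three_in_N[of v' "hd R" "last Q"] v ne neQ ends_adj(2) sym hd_R_notin
      by (metis ends_in_N(2,3) last_in_set nonempty(1))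
    then show False
    proof
      assume "E v' (hd R)"
      then have e: "E (hd L) v'" unfolding hL(2) by (rule sym)
      show False
      proof (rule no_spanning[of "[x] @ rev Q @ [v] @ M @ rev L @ (v' # S)"])
        show "successively E ([x] @ rev Q @ [v] @ M @ rev L @ (v' # S))"
          using e p L M paths(1) adj' yu by (auto simp: pathsimps)
      qed (use distinct_pieces x_notin R lb in auto)
    next
      assume "E v' (last Q)"
      then have e: "E (last Q) v'" by (rule sym)
      show False
      proof (rule no_spanning[of "[x] @ rev L @ rev M @ [v] @ Q @ (v' # S)"])
        show "successively E ([x] @ rev L @ rev M @ [v] @ Q @ (v' # S))"
          using e p L M paths(1) adj yh lL by (auto simp: pathsimps)
      qed (use distinct_pieces x_notin R lb in auto)
    qed
  qed
  show "S = []"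
  proof (rule ccontr)
    assume "S \<noteq> []"
    then obtain s S' where S: "S = s # S'" by (cases S) auto
    have "s \<notin> N" using succ_of_nbr_K[of "L @ v # M" v' s S'] R S v adj by auto
    then show False using inner_R[of "L @ v # M''" y v' s S'] R S y v lM by auto
  qed
qed

lemma two_nbrs_K:
  assumes R: "R = L @ v # M @ v' # S" and v: "v \<in> N" "v' \<in> N"
    and adj: "k \<in> K" "E v k" "k' \<in> K" "E v' k'"
  shows "L \<noteq> []" "last L \<in> N" "M \<noteq> []" "hd M \<notin> N" "last M \<notin> N" "S = []"
proof -
  obtain Q' where Q': "best_two_pieces E x W b Q' R" "hd Q' = k" "set Q' = set Q"
    using K_reorder[OF adj(1)] .
  interpret q: best_two_pieces E x W b Q' R by fact
  have "q.K = K" by (simp add: K_def q.K_def Q'(3))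
  then show "L \<noteq> []" "last L \<in> N" "M \<noteq> []" "hd M \<notin> N" "last M \<notin> N" "S = []"
    using q.two_nbrs_hd_Q[OF R v] adj Q'(2) by auto
qed

lemma nbr_avoiding:
  assumes "c \<noteq> hd R" "c \<notin> K"
  obtains k v where "k \<in> K" "v \<in> N" "v \<in> set R" "v \<noteq> c" "E v k"
proof -
  have "hd R \<notin> K" by (rule set_R_notin_K) simp
  have "\<exists>k \<in> K. \<exists>v \<in> N - K - {c}. E k v"
  proof (rule conn[where c = c])
    show "K \<union> (N - K - {c}) = N - {c}" using assms(2) by (auto simp: K_def)
    have "hd R \<in> N - K - {c}" using assms(1) \<open>hd R \<notin> K\<close> by simp
    then show "N - K - {c} \<noteq> {}" by blast
  qed (use K_nonempty(1) in auto)
  then obtain k v where "k \<in> K" "v \<in> N - K - {c}" "E k v" by blast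
  then show thesis using that N_minus_K sym by blast
qed

text \<open>By \<open>two_nbrs_K\<close>, of two vertices of \<open>R\<close> in \<open>N\<close>
  with neighbours in \<open>K\<close> the later one is \<open>b\<close>. Connectedness of
  \<open>N\<close> is used three times: with \<open>x\<close>, which removes nothing, to see that
  \<open>b\<close> is not \<open>hd R\<close>; then without \<open>b\<close>, to find
  \<open>v\<close>; and without \<open>v\<close>, to find \<open>b\<close>.\<close>

lemma first_nbr_K:
  obtains L v M k k' where "R = L @ v # M @ [b]" "v \<in> N" "k \<in> K" "E v k" "b \<in> N" "k' \<in> K" "E b k'"
    "L \<noteq> []" "last L \<in> N" "M \<noteq> []" "hd M \<notin> N" "last M \<notin> N"
    "\<forall>u \<in> set R \<inter> N. \<forall>k \<in> K. E u k \<longrightarrow> u = v \<or> u = b"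
proof -
  have bR: "b \<in> set R" using last_in_set[of R] by simp
  have xK: "x \<notin> K" by (simp add: K_def)
  have hx: "x \<noteq> hd R" using x_notin(2) by (metis hd_in_set nonempty(2))
  obtain k0 v0 where 0: "k0 \<in> K" "v0 \<in> N" "v0 \<in> set R" "E v0 k0"
    using nbr_avoiding[OF hx xK] by blast
  have "v0 \<noteq> hd R" using 0 K_nonadj(2) by blast
  have hb: "b \<noteq> hd R"
  proof
    assume "b = hd R"
    then have "R = [b]" using distinct_pieces(2) last_R
      by (metis distinct.simps(2) last_ConsR last_in_set list.collapse nonempty(2))
    then show False using 0 \<open>v0 \<noteq> hd R\<close> by simp
  qed
  obtain k v where v: "k \<in> K" "v \<in> N" "v \<in> set R" "v \<noteq> b" "E v k"
    using nbr_avoiding[OF hb set_R_notin_K[OF bR]] by blast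
  have pos: "u = b \<and> (\<exists>L M. R = L @ v # M @ [b] \<and> L \<noteq> [] \<and> last L \<in> N \<and> M \<noteq> [] \<and> hd M \<notin> N \<and> last M \<notin> N)"
    if u: "k' \<in> K" "u \<in> N" "u \<in> set R" "u \<noteq> v" "E u k'" for u k'
  proof -
    obtain L T where R: "R = L @ v # T" using v(3) by (meson split_list)
    show ?thesis
    proof (cases "u \<in> set T")
      case True
      then obtain M S where "T = M @ u # S" by (meson split_list)
      then show ?thesis using two_nbrs_K[of L v M u S k k'] R u v last_R by force
    next
      case False
      then have "u \<in> set L" using R u by auto
      then obtain L1 L2 where "L = L1 @ u # L2" by (meson split_list)
      then have "T = []" using two_nbrs_K[of L1 u L2 v T k' k] R u v by auto
      then show ?thesis using v(4) last_R R by simp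
    qed
  qed
  have "v \<noteq> hd R" using v K_nonadj(2) by blast
  then obtain k' v' where v': "k' \<in> K" "v' \<in> N" "v' \<in> set R" "v' \<noteq> v" "E v' k'"
    using nbr_avoiding[OF _ set_R_notin_K[OF v(3)]] by blast
  from pos[OF v'] obtain L M where LM: "v' = b" "R = L @ v # M @ [b]" "L \<noteq> []" "last L \<in> N" "M \<noteq> []"
    "hd M \<notin> N" "last M \<notin> N" by blast
  show thesis
    using that[of L v M k k'] LM v v' pos by blast
qed

lemma no_best_two_pieces: False
proof -
  obtain L v M k k' where R: "R = L @ v # M @ [b]" and v: "v \<in> N" "k \<in> K" "E v k"
    and b: "b \<in> N" "k' \<in> K" "E b k'"
    and L: "L \<noteq> []" "last L \<in> N" and M: "M \<noteq> []" "hd M \<notin> N" "last M \<notin> N"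
    and only: "\<forall>u \<in> set R \<inter> N. \<forall>k \<in> K. E u k \<longrightarrow> u = v \<or> u = b"
    by (rule first_nbr_K)
  define A where "A = N - K - {v, b}"
  have hL: "hd L \<in> N" "hd R = hd L" using ends_in_N(3) R L by simp_all
  have p: "successively E L" "E (last L) v" "E v (last L)" "E v (hd M)" "E (hd M) v" "successively E M"
      "E (last M) b" "E b (last M)"
    using paths(2) R L M commute[of v "hd M"] commute[of v "last L"] commute[of b "last M"]
    by (simp_all add: pathsimps)
  have d: "distinct L" "distinct M" "v \<notin> set L" "v \<notin> set M" "b \<notin> set L" "b \<notin> set M" "v \<noteq> b"
      "set L \<inter> set M = {}"
    using distinct_pieces(2) R by auto
  have dQ: "v \<notin> set Q" "b \<notin> set Q" "set L \<inter> set Q = {}" "set M \<inter> set Q = {}"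
    using distinct_pieces(3) R by auto
  have A_R: "w \<in> A \<longleftrightarrow> w \<in> N \<and> w \<in> set L \<union> set M" for w
    using N_minus_K[of w] set_R_notin_K[of w] d R by (auto simp: A_def)
  have A_nonadj: "\<not> E w t" "\<not> E t w" if "w \<in> A" "t \<in> K" for w t
    using only that A_R[of w] R sym[of t w] by (auto simp: A_def)
  have A_clique: "E w w'" if "w \<in> A" "w' \<in> A" "w \<noteq> w'" for w w'
    using three_in_N[of w w' "hd Q"] that A_nonadj(1)[OF _ K_nonempty(1)] K_nonempty(1)
    by (metis A_def DiffD1 DiffD2 ends_in_N(1))
  have LA: "hd L \<in> A" "last L \<in> A" using A_R hL L by auto
  have reorder: "\<exists>Q'. best_two_pieces E x W b Q' R \<and> hd Q' = t \<and> set Q' = set Q" if "t \<in> K" for t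
    using K_reorder[OF that] by blast
  \<comment> \<open>Such an edge would connect \<open>Q'\<close> with the end of \<open>M\<close>,
    while \<open>b\<close> can be reached from \<open>last Q'\<close> or from \<open>hd L\<close>,
    which are not adjacent to each other.\<close>
  have nonadj_K: "\<not> E (last M) t" if t: "t \<in> K" "E b t" for t
  proof
    assume lt: "E (last M) t"
    obtain Q' where Q': "best_two_pieces E x W b Q' R" "hd Q' = t" "set Q' = set Q" using reorder[OF t(1)] by blast
    interpret q: best_two_pieces E x W b Q' R by fact
    have lt': "E (hd Q') (last M)" using lt Q'(2) sym by simp
    have "b \<noteq> hd L" using d L by auto
    have "b \<noteq> last Q'" using dQ Q'(3) last_in_set[of Q'] q.nonempty by auto
    then have "E b (last Q') \<or> E b (hd L)"
      using three_in_N[of b "last Q'" "hd L"] b hL q.ends_adj(2) q.hd_R_notin \<open>b \<noteq> hd L\<close>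
      by (metis last_in_set q.ends_in_N(2) q.nonempty(1))
    then show False
    proof
      assume "E b (last Q')"
      then have e: "E (last Q') b" by (rule sym)
      show False
      proof (rule q.no_spanning[of "[x] @ L @ [v] @ M @ Q' @ [b]"])
        show "successively E ([x] @ L @ [v] @ M @ Q' @ [b])"
          using e hL(1) lt Q'(2) p q.paths(1) L M by (auto simp: pathsimps)
      qed (use q.distinct_pieces q.x_notin R in auto)
    next
      assume "E b (hd L)"
      then have e: "E (hd L) b" by (rule sym)
      show False
      proof (rule q.no_spanning[of "[x] @ rev Q' @ rev M @ [v] @ rev L @ [b]"])
        show "successively E ([x] @ rev Q' @ rev M @ [v] @ rev L @ [b])"
          using e lt' p q.paths(1) L M by (auto simp: pathsimps)
      qed (use q.distinct_pieces q.x_notin R in auto)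
    qed
  qed
  \<comment> \<open>The leaves \<open>last M\<close>, \<open>k'\<close> and \<open>w\<close> would
    otherwise form a claw at \<open>b\<close>.\<close>
  have far: "E (last M) w" "E w (last M)" if w: "w \<in> A" "E b w" for w
  proof -
    have "last M \<noteq> k'" "last M \<noteq> w" "k' \<noteq> w" "last M \<noteq> x"
      using M w b last_in_set[OF M(1)] x_notin R by (auto simp: A_def K_def)
    then show "E (last M) w"
      using no_claw[of b "last M" k' w] p(8) b w nonadj_K[OF b(2,3)] A_nonadj(2)[OF w(1) b(2)] by auto
    then show "E w (last M)" by (rule sym)
  qed
  obtain Q' where Q': "best_two_pieces E x W b Q' R" "hd Q' = k" "set Q' = set Q"
    using reorder[OF v(2)] by blast
  interpret q: best_two_pieces E x W b Q' R by fact
  have vk: "E (hd Q') v" "E v (hd Q')" using v(3) Q'(2) sym by auto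
  \<comment> \<open>A vertex of \<open>K\<close> not adjacent to \<open>b\<close> would force
    \<open>b\<close> to be adjacent to all of \<open>A\<close>. Then \<open>last M\<close> is joined
    to \<open>hd L\<close>, and \<open>last L\<close> to \<open>b\<close>.\<close>
  have all_K: "E b t" if t: "t \<in> K" for t
  proof (rule ccontr)
    assume nt: "\<not> E b t"
    have bA: "E b w" if "w \<in> A" for w
      using three_in_N[of b t w] nt A_nonadj(2)[OF that t] t b that dQ by (auto simp: A_def K_def)
    have e: "E (last M) (hd L)" "E (last L) b" using far bA LA sym by blast+
    show False
    proof (rule q.no_spanning[of "[x] @ rev Q' @ [v] @ M @ L @ [b]"])
      show "successively E ([x] @ rev Q' @ [v] @ M @ L @ [b])"
        using e vk p q.paths(1) L M by (auto simp: pathsimps)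
    qed (use q.distinct_pieces q.x_notin R in auto)
  qed
  have "last Q' \<in> K" using q.nonempty(1) Q'(3) by (auto simp: K_def)
  then have lQb: "E (last Q') b" using all_K sym by blast
  have bK: "b \<notin> K" using dQ by (simp add: K_def)
  \<comment> \<open>Removing \<open>v\<close> must not separate \<open>K\<close> and
    \<open>b\<close> from \<open>A\<close>.\<close>
  have "\<exists>u \<in> insert b K. \<exists>w \<in> A. E u w"
    using b d(7) v(1) LA dQ by (intro conn[where c = v]) (auto simp: A_def K_def)
  then obtain w where w: "w \<in> A" "E b w" using A_nonadj(2) by blast
  have wN: "w \<in> N" using w by (simp add: A_def)
  have "w \<in> set L \<or> w \<in> set M" using w A_R by auto
  then show False
  proof
    assume wL: "w \<in> set L"
    \<comment> \<open>The ends of \<open>L\<close> lie in the clique \<open>A\<close>, so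
      \<open>L\<close> can be reordered to start at \<open>w\<close> just as \<open>Q\<close> can at
      a vertex of \<open>K\<close>.\<close>
    have inn: "u \<in> N \<or> z \<in> N" if "L = B @ [u, y, z] @ C" "y \<in> N" for B u y z C
      using inner_R[of B u y z "C @ v # M @ [b]"] that R by auto
    have cl: "hd L = last L \<or> E (hd L) (last L)" using A_clique LA by blast
    obtain L' where L': "set L' = set L" "distinct L'" "successively E L'" "L' \<noteq> []" "hd L' = w"
      "last L' \<in> N" "inner_steps L' = inner_steps L"
      by (rule reorder_from[OF d(1) p(1) L(1) hL(1) L(2) cl inn wL wN])
    show False
    proof (rule q.no_spanning[of "[x] @ rev L' @ rev M @ [v] @ Q' @ [b]"])
      show "successively E ([x] @ rev L' @ rev M @ [v] @ Q' @ [b])"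
        using L' far(2)[OF w] lQb vk p q.paths(1) M by (auto simp: pathsimps)
    qed (use q.distinct_pieces q.x_notin R L' in auto)
  next
    assume wM: "w \<in> set M"
    then obtain C D where CD: "M = C @ w # D" by (meson split_list)
    have C: "C \<noteq> []" using M(2) wN CD by auto
    have D: "D \<noteq> []" using M(3) wN CD by auto
    obtain C' c where c: "C = C' @ [c]" using C by (metis append_butlast_last_id)
    obtain e D' where e: "D = e # D'" using D by (cases D) auto
    have pM: "successively E C" "E (last C) w" "E w (last C)" "successively E D" "E w (hd D)" "E (hd C) v"
        "E v (hd C)" "E (last D) b"
      using p CD C D commute[of w "last C"] by (simp_all add: pathsimps)
    \<comment> \<open>The neighbour of \<open>w\<close> found in \<open>N\<close> belongs to the
      clique \<open>A\<close> and so has a chord to an end of \<open>L\<close>.\<close>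
    have "c \<in> N \<or> e \<in> N" using inner_R[of "L @ v # C'" c w e "D' @ [b]"] R CD c e wN by auto
    then show False
    proof
      assume cN: "c \<in> N"
      have "c \<in> A" using cN A_R CD c by auto
      have "hd L \<noteq> c" "last L \<noteq> w" using d(8) hd_in_set[OF L(1)] last_in_set[OF L(1)] CD c by auto
      then have "E c (hd L)" "E (last L) w" using A_clique \<open>c \<in> A\<close> w(1) LA by auto
      then have 1: "E (last C) (hd L)" "E (last L) w" by (simp_all add: c)
      show False
      proof (rule q.no_spanning[of "[x] @ rev Q' @ [v] @ C @ L @ [w] @ D @ [b]"])
        show "successively E ([x] @ rev Q' @ [v] @ C @ L @ [w] @ D @ [b])"
          using 1 vk pM p(1) q.paths(1) L(1) C D by (auto simp: pathsimps)
      qed (use q.distinct_pieces q.x_notin R CD in auto)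
    next
      assume eN: "e \<in> N"
      have "e \<in> A" using eN A_R CD e by auto
      moreover have "last L \<noteq> e" using d(8) last_in_set[OF L(1)] CD e by auto
      ultimately have 1: "E (last L) (hd D)" using A_clique[of "last L" e] LA e by auto
      have 2: "E (last D) w" using far(1)[OF w] CD D by simp
      show False
      proof (rule q.no_spanning[of "[x] @ L @ D @ [w] @ rev C @ [v] @ Q' @ [b]"])
        show "successively E ([x] @ L @ D @ [w] @ rev C @ [v] @ Q' @ [b])"
          using 1 2 hL(1) lQb vk pM p(1) q.paths(1) L(1) C D by (auto simp: pathsimps)
      qed (use q.distinct_pieces q.x_notin R CD in auto)
    qed
  qed
qed

end

section \<open>From paths of the completed graph to path systems\<close>

context clique_closing
begin

definition closed_adj :: "'a \<Rightarrow> 'a \<Rightarrow> bool" where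
  "closed_adj u v \<longleftrightarrow> E u v \<or> u \<in> N \<and> v \<in> N \<and> u \<noteq> v"

text \<open>A path of the completion after cutting at added edges. Both sides of every cut lie in
  \<open>N\<close>, so pieces other than the first and the last can be permuted and turned
  around.\<close>

definition pieces :: "'a list list \<Rightarrow> bool" where
  "pieces ps \<longleftrightarrow> ps \<noteq> [] \<and> (\<forall>q \<in> set ps. q \<noteq> [] \<and> successively E q) \<and>
     successively (\<lambda>q r. last q \<in> N \<and> hd r \<in> N) ps"

lemma pieces_append:
  "pieces ps \<Longrightarrow> pieces qs \<Longrightarrow> last (last ps) \<in> N \<Longrightarrow> hd (hd qs) \<in> N \<Longrightarrow> pieces (ps @ qs)"
  by (auto simp: pieces_def successively_append_iff)

lemma hd_last_concat:
  assumes "ps \<noteq> []" "\<forall>q \<in> set ps. q \<noteq> []"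
  shows "hd (concat ps) = hd (hd ps)" "last (concat ps) = last (last ps)"
proof -
  show "hd (concat ps) = hd (hd ps)" using assms by (cases ps) auto
  show "last (concat ps) = last (last ps)" using assms by (cases ps rule: rev_cases) auto
qed

lemma split_into_pieces:
  assumes "successively closed_adj p" "p \<noteq> []"
  obtains ps where "pieces ps" "concat ps = p" "hd (hd ps) = hd p" "last (last ps) = last p"
proof -
  have "\<exists>ps. pieces ps \<and> concat ps = p" using assms
  proof (induction p)
    case (Cons u p)
    show ?case
    proof (cases "p = []")
      case True
      then show ?thesis by (intro exI[of _ "[[u]]"]) (simp add: pieces_def)
    next
      case False
      then obtain ps where ps: "pieces ps" "concat ps = p" using Cons by (auto simp: successively_Cons)
      have hd_p: "hd p = hd (hd ps)" using hd_last_concat(1)[of ps] ps by (auto simp: pieces_def)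
      obtain q qs where q: "ps = q # qs" using ps(1) by (cases ps) (auto simp: pieces_def)
      have "closed_adj u (hd p)" using Cons.prems False by (simp add: successively_Cons)
      then consider "E u (hd q)" | "u \<in> N" "hd q \<in> N" by (auto simp: closed_adj_def hd_p q)
      then show ?thesis
      proof cases
        case 1
        then have "pieces ((u # q) # qs)" using ps(1) by (auto simp: q pieces_def successively_Cons)
        moreover have "concat ((u # q) # qs) = u # p" using ps(2) q by simp
        ultimately show ?thesis by blast
      next
        case 2
        then have "pieces ([u] # ps)" using ps(1) by (auto simp: q pieces_def successively_Cons)
        moreover have "concat ([u] # ps) = u # p" using ps(2) by simp
        ultimately show ?thesis by blast
      qed
    qed
  qed simp
  then obtain ps where "pieces ps" "concat ps = p" by blast
  moreover from this have "hd (hd ps) = hd p" "last (last ps) = last p"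
    using hd_last_concat[of ps] by (auto simp: pieces_def)
  ultimately show thesis by (rule that)
qed

definition pieces_of :: "'a list list \<Rightarrow> bool" where
  "pieces_of ps \<longleftrightarrow> pieces ps \<and> distinct (concat ps) \<and> set (concat ps) = W - {x}"

text \<open>Two of \<open>last p\<close>, \<open>hd q\<close>, \<open>hd r\<close> are adjacent, and
  joining pieces there shortens the list. A fourth piece ensures that \<open>r\<close> is not the
  last one, whose end is prescribed.\<close>

lemma reduce_pieces_between:
  assumes "pieces_of ps" "hd (hd ps) = a" "last (last ps) = b" "length ps \<ge> 2"
  shows "\<exists>ps. pieces_of ps \<and> hd (hd ps) = a \<and> last (last ps) = b \<and> (length ps = 2 \<or> length ps = 3)"
  using assms
proof (induction "length ps" arbitrary: ps rule: less_induct)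
  case less
  show ?case
  proof (cases "length ps \<le> 3")
    case True
    then have "length ps = 2 \<or> length ps = 3" using less.prems(4) by auto
    then show ?thesis using less.prems by blast
  next
    case False
    then have "Suc (Suc (Suc (Suc 0))) \<le> length ps" by simp
    then obtain p q r s rest where ps: "ps = p # q # r # s # rest"
      unfolding Suc_le_length_iff by blast
    have ne: "p \<noteq> []" "q \<noteq> []" "r \<noteq> []" and N: "last p \<in> N" "hd q \<in> N" "hd r \<in> N"
      using less.prems by (auto simp: ps pieces_of_def pieces_def)
    have "set p \<inter> set q = {}" "set p \<inter> set r = {}" "set q \<inter> set r = {}"
      using less.prems(1) by (auto simp: ps pieces_of_def)
    then have "last p \<noteq> hd q" "last p \<noteq> hd r" "hd q \<noteq> hd r"
      using ne by (metis disjoint_iff hd_in_set last_in_set)+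
    then consider "E (last p) (hd q)" | "E (last p) (hd r)" | "E (hd q) (hd r)"
      using three_in_N N by blast
    then show ?thesis
    proof cases
      case 1
      show ?thesis
        by (rule less.hyps[of "(p @ q) # r # s # rest"])
          (use less.prems 1 ne in \<open>auto simp: ps pieces_of_def pieces_def pathsimps\<close>)
    next
      case 2
      show ?thesis
        by (rule less.hyps[of "(p @ r) # q # s # rest"])
          (use less.prems 2 ne in \<open>auto simp: ps pieces_of_def pieces_def pathsimps\<close>)
    next
      case 3
      show ?thesis
        by (rule less.hyps[of "p # (rev q @ r) # s # rest"])
          (use less.prems 3 ne in \<open>auto simp: ps pieces_of_def pieces_def pathsimps\<close>)
    qed
  qed
qed

text \<open>Here the first piece starts in \<open>N\<close> and can be turned around and moved as
  well, so the reduction gets down to two pieces.\<close>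

lemma reduce_pieces_to:
  assumes "pieces_of ps" "hd (hd ps) \<in> N" "last (last ps) = b"
  shows "\<exists>ps. pieces_of ps \<and> hd (hd ps) \<in> N \<and> last (last ps) = b \<and> (length ps = 1 \<or> length ps = 2)"
  using assms
proof (induction "length ps" arbitrary: ps rule: less_induct)
  case less
  have "length ps \<ge> 1" using less.prems by (cases ps) (auto simp: pieces_of_def pieces_def)
  show ?case
  proof (cases "length ps \<le> 2")
    case True
    then have "length ps = 1 \<or> length ps = 2" using \<open>length ps \<ge> 1\<close> by auto
    then show ?thesis using less.prems by blast
  next
    case False
    then have "Suc (Suc (Suc 0)) \<le> length ps" by simp
    then obtain p q r rest where ps: "ps = p # q # r # rest"
      unfolding Suc_le_length_iff by blast
    have ne: "p \<noteq> []" "q \<noteq> []" "r \<noteq> []" and N: "hd p \<in> N" "hd q \<in> N" "hd r \<in> N"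
      using less.prems by (auto simp: ps pieces_of_def pieces_def)
    have "set p \<inter> set q = {}" "set p \<inter> set r = {}" "set q \<inter> set r = {}"
      using less.prems(1) by (auto simp: ps pieces_of_def)
    then have "hd p \<noteq> hd q" "hd p \<noteq> hd r" "hd q \<noteq> hd r"
      using ne by (metis disjoint_iff hd_in_set last_in_set)+
    then consider "E (hd p) (hd q)" | "E (hd p) (hd r)" | "E (hd q) (hd r)"
      using three_in_N N by blast
    then show ?thesis
    proof cases
      case 1
      show ?thesis
        by (rule less.hyps[of "(rev p @ q) # r # rest"])
          (use less.prems 1 ne in \<open>auto simp: ps pieces_of_def pieces_def pathsimps\<close>)
    next
      case 2
      show ?thesis
        by (rule less.hyps[of "q # (rev p @ r) # rest"])
          (use less.prems 2 ne in \<open>auto simp: ps pieces_of_def pieces_def pathsimps\<close>)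
    next
      case 3
      show ?thesis
        by (rule less.hyps[of "p # (rev q @ r) # rest"])
          (use less.prems 3 ne in \<open>auto simp: ps pieces_of_def pieces_def pathsimps\<close>)
    qed
  qed
qed

end

section \<open>Spanning paths or a split neighbourhood\<close>

locale clique_closing_2conn = clique_closing +
  assumes conn: "U \<union> V = N - {c} \<Longrightarrow> U \<inter> V = {} \<Longrightarrow> U \<noteq> {} \<Longrightarrow> V \<noteq> {} \<Longrightarrow> \<exists>u\<in>U. \<exists>v\<in>V. E u v"
begin

text \<open>A single piece is simply preceded by \<open>x\<close>. If two pieces remain, a system of
  two with the most inner steps contradicts \<open>no_best_two_pieces\<close>.\<close>

lemma spans_from_centre:
  assumes p: "distinct p" "successively closed_adj p" "set p = W" "hd p = x" "last p = b" "b \<noteq> x"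
  shows "\<exists>p. spans x b p"
proof (rule ccontr)
  assume no: "\<not> ?thesis"
  interpret u: unspanned_centre E x W b using no by unfold_locales blast
  obtain p' where p': "p = x # p'" using p(3,4) x_in_W by (cases p) auto
  have ne: "p' \<noteq> []" using p p' by auto
  have "closed_adj x (hd p')" using p(2) p' ne by (simp add: successively_Cons)
  then have hd: "hd p' \<in> N" by (simp add: closed_adj_def)
  obtain ps where ps: "pieces ps" "concat ps = p'" "hd (hd ps) = hd p'" "last (last ps) = last p'"
    using split_into_pieces[of p'] p(2) p' ne by (metis successively_Cons)
  have "pieces_of ps" using ps p p' by (auto simp: pieces_of_def)
  then obtain ps where ps: "pieces_of ps" "hd (hd ps) \<in> N" "last (last ps) = b" "length ps = 1 \<or> length ps = 2"
    using reduce_pieces_to[of ps b] ps hd p p' ne by auto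
  from ps(4) show False
  proof
    assume "length ps = 1"
    then obtain q where q: "ps = [q]" by (auto simp: length_Suc_conv)
    have "insert x (W - {x}) = W" using x_in_W by auto
    then have "spans x b (x # q)"
      using ps by (auto simp: q spans_def pieces_of_def pieces_def successively_Cons)
    then show False using no by blast
  next
    assume "length ps = 2"
    then obtain q r where q: "ps = [q, r]" by (auto simp: length_Suc_conv numeral_eq_Suc)
    have two: "u.two_pieces q r"
      using ps by (auto simp: q u.two_pieces_def pieces_of_def pieces_def)
    have bound: "inner_steps q + inner_steps r \<le> card W" if qr: "u.two_pieces q r" for q r
    proof -
      have "inner_steps q + inner_steps r \<le> length (q @ r)"
        using inner_steps_le[of q] inner_steps_le[of r] by simp
      also have "\<dots> = card (W - {x})" using qr distinct_card by (metis u.two_pieces_def)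
      also have "\<dots> \<le> card W" using finite_W by (intro card_mono) auto
      finally show ?thesis .
    qed
    let ?f = "\<lambda>(q, r). inner_steps q + inner_steps r"
    \<comment> \<open>A system with the most inner steps exists because their number is bounded by
      the size of \<open>W\<close>.\<close>
    have "\<exists>k. (case k of (q, r) \<Rightarrow> u.two_pieces q r) \<and>
      (\<forall>k'. (case k' of (q, r) \<Rightarrow> u.two_pieces q r) \<longrightarrow> ?f k' \<le> ?f k)"
      by (rule ex_has_greatest_nat[of _ "(q, r)" _ "Suc (card W)"]) (use two bound in \<open>auto simp: less_Suc_eq_le\<close>)
    then obtain Q R where QR: "u.two_pieces Q R"
      "\<And>q r. u.two_pieces q r \<Longrightarrow> inner_steps q + inner_steps r \<le> inner_steps Q + inner_steps R"
      by auto
    interpret t: best_two_pieces E x W b Q R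
      using QR conn by unfold_locales auto
    show False by (rule t.no_best_two_pieces)
  qed
qed

text \<open>By \<open>spans_from_centre\<close>, used from both ends, \<open>x\<close> is an inner
  vertex of the path. The pieces on its two sides reduce to two, which \<open>x\<close> would join
  to a spanning path, or to three, from which a best system is chosen.\<close>

lemma split_nbhd_if_not_spans:
  assumes p: "distinct p" "successively closed_adj p" "set p = W" "hd p = a" "last p = b" "a \<noteq> b"
    and no: "\<not> (\<exists>p. spans a b p)"
  shows "split_nbhd E x a b"
proof -
  have flip: "(\<lambda>u v. closed_adj v u) = closed_adj" by (auto simp: closed_adj_def fun_eq_iff commute)
  have rp: "successively closed_adj (rev p)" using p(2) by (simp only: successively_rev flip)
  have pne: "p \<noteq> []" using p(3) x_in_W by auto
  have "a \<noteq> x" using spans_from_centre[of p b] p no by auto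
  moreover have "b \<noteq> x"
    using spans_from_centre[of "rev p" a] rp p no spans_rev by (auto simp: hd_rev last_rev)
  moreover obtain L R where LR: "p = L @ x # R" using p(3) x_in_W by (meson split_list)
  ultimately have ne: "L \<noteq> []" "R \<noteq> []" using p by auto
  have pL: "successively closed_adj L" "successively closed_adj R" "closed_adj (last L) x" "closed_adj x (hd R)"
    using p(2) ne by (auto simp: LR successively_append_iff successively_Cons)
  then have N: "last L \<in> N" "hd R \<in> N" by (auto simp: closed_adj_def)
  interpret u: unspanned E x W a b using no by unfold_locales blast
  obtain ps where ps: "pieces ps" "concat ps = L" "hd (hd ps) = hd L" "last (last ps) = last L"
    by (rule split_into_pieces[OF pL(1) ne(1)])
  obtain qs where qs: "pieces qs" "concat qs = R" "hd (hd qs) = hd R" "last (last qs) = last R"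
    by (rule split_into_pieces[OF pL(2) ne(2)])
  have nil: "ps \<noteq> []" "qs \<noteq> []" using ps qs by (auto simp: pieces_def)
  have "pieces_of (ps @ qs)"
    using pieces_append[OF ps(1) qs(1)] ps qs N p LR by (auto simp: pieces_of_def)
  moreover have "length (ps @ qs) \<ge> 2" using nil by (cases ps; cases qs) auto
  moreover have "hd (hd (ps @ qs)) = a" "last (last (ps @ qs)) = b" using nil ps qs p LR ne by auto
  ultimately obtain rs where rs: "pieces_of rs" "hd (hd rs) = a" "last (last rs) = b"
    "length rs = 2 \<or> length rs = 3"
    using reduce_pieces_between by blast
  from rs(4) show ?thesis
  proof
    assume "length rs = 2"
    then obtain q r where q: "rs = [q, r]" by (auto simp: length_Suc_conv numeral_eq_Suc)
    have "insert x (W - {x}) = W" using x_in_W by auto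
    then have "spans a b (q @ x # r)"
      using rs by (auto simp: q spans_def pieces_of_def pieces_def pathsimps)
    then show ?thesis using no by blast
  next
    assume "length rs = 3"
    then obtain P Q R where q: "rs = [P, Q, R]" by (auto simp: length_Suc_conv numeral_eq_Suc)
    have three: "u.three_pieces P Q R"
      using rs by (auto simp: q u.three_pieces_def pieces_of_def pieces_def)
    have bound: "inner_steps P + inner_steps Q + inner_steps R \<le> card W"
      if qr: "u.three_pieces P Q R" for P Q R
    proof -
      have "inner_steps P + inner_steps Q + inner_steps R \<le> length (P @ Q @ R)"
        using inner_steps_le[of P] inner_steps_le[of Q] inner_steps_le[of R] by simp
      also have "\<dots> = card (W - {x})" using qr distinct_card by (metis u.three_pieces_def)
      also have "\<dots> \<le> card W" using finite_W by (intro card_mono) auto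
      finally show ?thesis .
    qed
    let ?f = "\<lambda>(P, Q, R). inner_steps P + inner_steps Q + inner_steps R"
    have "\<exists>k. (case k of (P, Q, R) \<Rightarrow> u.three_pieces P Q R) \<and>
      (\<forall>k'. (case k' of (P, Q, R) \<Rightarrow> u.three_pieces P Q R) \<longrightarrow> ?f k' \<le> ?f k)"
      by (rule ex_has_greatest_nat[of _ "(P, Q, R)" _ "Suc (card W)"]) (use three bound in \<open>auto simp: less_Suc_eq_le\<close>)
    then obtain P Q R where PQR: "u.three_pieces P Q R"
      "\<And>P' Q' R'. u.three_pieces P' Q' R' \<Longrightarrow>
        inner_steps P' + inner_steps Q' + inner_steps R' \<le> inner_steps P + inner_steps Q + inner_steps R"
      by auto
    interpret t: best_pieces_2conn E x W a b P Q R
      using PQR conn by unfold_locales auto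
    show ?thesis by (rule t.split_nbhd)
  qed
qed

end

section \<open>Clique covers\<close>

definition clique :: "('a \<Rightarrow> 'a \<Rightarrow> bool) \<Rightarrow> 'a set \<Rightarrow> bool" where
  "clique E Q \<longleftrightarrow> (\<forall>u \<in> Q. \<forall>v \<in> Q. u \<noteq> v \<longrightarrow> E u v)"

text \<open>A \<open>c\<close> outside of \<open>S\<close> is allowed, so connectedness of \<open>S\<close> itself is included.\<close>

definition twice_connected :: "('a \<Rightarrow> 'a \<Rightarrow> bool) \<Rightarrow> 'a set \<Rightarrow> bool" where
  "twice_connected E S \<longleftrightarrow> (\<forall>c U V. U \<union> V = S - {c} \<longrightarrow> U \<inter> V = {} \<longrightarrow> U \<noteq> {} \<longrightarrow> V \<noteq> {} \<longrightarrow>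
     (\<exists>u \<in> U. \<exists>v \<in> V. E u v))"

text \<open>The vertices that may lie in more than three maximal cliques, by
  \<open>max_cliques_not_eligible\<close>. As the neighbourhood is not a clique, completing there
  changes the graph.\<close>

definition eligible :: "('a \<Rightarrow> 'a \<Rightarrow> bool) \<Rightarrow> 'a \<Rightarrow> bool" where
  "eligible E x \<longleftrightarrow> \<not> clique E {v. E x v} \<and> twice_connected E {v. E x v}"

lemma card_le_3: "S \<subseteq> {A, B, C} \<Longrightarrow> card S \<le> 3"
  by (rule order_trans[OF card_mono[of "{A, B, C}"]]) (auto simp: card_insert_if)

section \<open>Maximal cliques through a vertex\<close>

locale finite_claw_free = claw_free_rel +
  fixes V :: "'a set"
  assumes finite_V: "finite V" and E_in_V: "E u v \<Longrightarrow> v \<in> V"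
begin

definition max_clique :: "'a set \<Rightarrow> bool" where
  "max_clique Q \<longleftrightarrow> Q \<subseteq> V \<and> clique E Q \<and> (\<forall>Q'. Q \<subseteq> Q' \<longrightarrow> Q' \<subseteq> V \<longrightarrow> clique E Q' \<longrightarrow> Q' = Q)"

lemma finite_max_cliques: "finite {Q. max_clique Q}"
  by (rule finite_subset[of _ "Pow V"]) (auto simp: max_clique_def finite_V)

lemma max_clique_adj: "max_clique Q \<Longrightarrow> u \<in> Q \<Longrightarrow> v \<in> Q \<Longrightarrow> u \<noteq> v \<Longrightarrow> E u v"
  by (simp add: max_clique_def clique_def)

lemma extend_clique:
  assumes "clique E S" "S \<subseteq> V"
  obtains Q where "max_clique Q" "S \<subseteq> Q"
proof -
  let ?F = "{Q. S \<subseteq> Q \<and> Q \<subseteq> V \<and> clique E Q}"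
  have "finite ?F" by (rule finite_subset[of _ "Pow V"]) (auto simp: finite_V)
  moreover have "S \<in> ?F" using assms by simp
  ultimately obtain Q where "Q \<in> ?F" "\<forall>Q' \<in> ?F. Q \<subseteq> Q' \<longrightarrow> Q' = Q"
    by (metis (no_types, lifting) finite_has_maximal2)
  then show thesis using that[of Q] by (auto simp: max_clique_def)
qed

lemma clique_insert:
  assumes "clique E S" "\<And>v. v \<in> S \<Longrightarrow> v \<noteq> x \<Longrightarrow> E x v"
  shows "clique E (insert x S)"
proof -
  have "E v x" if "v \<in> S" "v \<noteq> x" for v using assms(2)[OF that] by (rule sym)
  then show ?thesis using assms by (auto simp: clique_def)
qed

lemma clique_insert_nbrs:
  "clique E S \<Longrightarrow> S \<subseteq> {v. E x v} \<Longrightarrow> clique E (insert x S)"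
  by (rule clique_insert) auto

lemma clique_pair: "E u v \<Longrightarrow> clique E {u, v}"
  by (intro clique_insert) (auto simp: clique_def)

lemma clique_triple: "E u v \<Longrightarrow> E u w \<Longrightarrow> E v w \<Longrightarrow> clique E {u, v, w}"
  by (intro clique_insert) (auto simp: clique_def)

lemma max_clique_eqI:
  assumes "max_clique Q" "Q \<subseteq> insert x S" "x \<in> V" "clique E S" "S \<subseteq> {v. E x v}"
  shows "Q = insert x S"
proof -
  have "insert x S \<subseteq> V" using assms(3,5) E_in_V by auto
  then show ?thesis
    using assms(1,2) clique_insert_nbrs[OF assms(4,5)] unfolding max_clique_def by metis
qed

lemma three_nbrs:
  assumes "E x u" "E x v" "E x w" "u \<noteq> v" "u \<noteq> w" "v \<noteq> w"
  shows "E u v \<or> E u w \<or> E v w"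
  using no_claw[OF assms] .

text \<open>\<open>U\<close> and \<open>T\<close> are cliques, since two non-adjacent vertices of
  one would form a claw at \<open>x\<close> with a vertex of the other. A maximal clique through
  \<open>x\<close> either meets \<open>U\<close>, or misses \<open>U\<close> and contains
  \<open>c\<close> as a neighbour of \<open>x\<close>, or lies in \<open>T\<close> apart from
  \<open>x\<close>; each case determines it.\<close>

lemma max_cliques_cut:
  assumes x: "x \<in> V" and UV: "U \<union> T = {v. E x v} - {c}" "U \<noteq> {}" "T \<noteq> {}" "U \<inter> T = {}"
    and none: "\<And>u v. u \<in> U \<Longrightarrow> v \<in> T \<Longrightarrow> \<not> E u v"
    and c: "E x c \<Longrightarrow> \<forall>u \<in> U. E c u"
  shows "card {Q. max_clique Q \<and> x \<in> Q} \<le> 3"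
proof -
  let ?N = "{v. E x v}"
  have none': "\<not> E v u" if "u \<in> U" "v \<in> T" for u v using none[OF that] sym by blast
  obtain u0 v0 where uv: "u0 \<in> U" "v0 \<in> T" using UV by blast
  have sub: "U \<subseteq> ?N" "T \<subseteq> ?N" "c \<notin> U" "c \<notin> T" using UV(1) by auto
  have cU: "clique E U"
    unfolding clique_def
  proof (intro ballI impI)
    fix u u' assume u: "u \<in> U" "u' \<in> U" "u \<noteq> u'"
    have "v0 \<noteq> u" "v0 \<noteq> u'" using u uv UV(4) by auto
    then show "E u u'" using three_nbrs[of x u u' v0] u uv none[of _ v0] sub by blast
  qed
  have cT: "clique E T"
    unfolding clique_def
  proof (intro ballI impI)
    fix u u' assume u: "u \<in> T" "u' \<in> T" "u \<noteq> u'"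
    have "u0 \<noteq> u" "u0 \<noteq> u'" using u uv UV(4) by auto
    then show "E u u'" using three_nbrs[of x u u' u0] u uv none'[of u0] sub by blast
  qed
  define U' where "U' = (if E x c then insert c U else U)"
  define T' where "T' = (if E x c then insert c {v \<in> T. E c v} else T)"
  have "clique E (insert c U)" if "E x c" using c[OF that] cU by (intro clique_insert) auto
  then have cU': "clique E U'" "U' \<subseteq> ?N" using cU sub by (auto simp: U'_def)
  have "clique E {v \<in> T. E c v}" using cT by (auto simp: clique_def)
  then have "clique E (insert c {v \<in> T. E c v})" by (rule clique_insert) auto
  then have cT': "clique E T'" "T' \<subseteq> ?N" using cT sub by (auto simp: T'_def)
  have "{Q. max_clique Q \<and> x \<in> Q} \<subseteq> {insert x U', insert x T', insert x T}"
  proof (rule subsetI)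
    fix Q assume "Q \<in> {Q. max_clique Q \<and> x \<in> Q}"
    then have Q: "max_clique Q" "x \<in> Q" by auto
    have QN: "Q \<subseteq> insert x ?N" using max_clique_adj[OF Q] by auto
    have mem: "v = x \<or> v \<in> U \<or> v \<in> T \<or> v = c \<and> E x c" if "v \<in> Q" for v
      using QN that UV(1) by blast
    consider u where "u \<in> Q" "u \<in> U" | "Q \<inter> U = {}" "c \<in> Q" "E x c" | "Q \<inter> U = {}" "c \<notin> Q \<or> \<not> E x c" by blast
    then show "Q \<in> {insert x U', insert x T', insert x T}"
    proof cases
      case 1
      have "v \<notin> T" if "v \<in> Q" for v
        using max_clique_adj[OF Q(1) 1(1) that] none[OF 1(2)] UV(4) 1(2) by blast
      then have "Q \<subseteq> insert x U'" using mem by (auto simp: U'_def)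
      from max_clique_eqI[OF Q(1) this x cU'] show ?thesis by simp
    next
      case 2
      have "E c v" if "v \<in> Q" "v \<in> T" for v
        using max_clique_adj[OF Q(1) 2(2) that(1)] that(2) sub(4) by blast
      then have "Q \<subseteq> insert x T'" using mem 2 by (auto simp: T'_def)
      from max_clique_eqI[OF Q(1) this x cT'] show ?thesis by simp
    next
      case 3
      then have "Q \<subseteq> insert x T" using mem by blast
      from max_clique_eqI[OF Q(1) this x cT sub(2)] show ?thesis by simp
    qed
  qed
  then show ?thesis by (rule card_le_3)
qed

lemma max_cliques_not_eligible:
  assumes x: "x \<in> V" and "\<not> eligible E x"
  shows "card {Q. max_clique Q \<and> x \<in> Q} \<le> 3"
proof (cases "clique E {v. E x v}")
  case True
  have "Q = insert x {v. E x v}" if "max_clique Q" "x \<in> Q" for Q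
    using max_clique_eqI[OF that(1) _ x True] max_clique_adj[OF that] by auto
  then have "{Q. max_clique Q \<and> x \<in> Q} \<subseteq> {insert x {v. E x v}, {}, {}}" by auto
  then show ?thesis by (rule card_le_3)
next
  case False
  then obtain c U T where UT: "U \<union> T = {v. E x v} - {c}" "U \<inter> T = {}" "U \<noteq> {}" "T \<noteq> {}"
    and none: "\<And>u v. u \<in> U \<Longrightarrow> v \<in> T \<Longrightarrow> \<not> E u v"
    using assms(2) unfolding eligible_def twice_connected_def by blast
  have none': "\<not> E v u" if "u \<in> U" "v \<in> T" for u v using none[OF that] sym by blast
  \<comment> \<open>Non-neighbours of \<open>c\<close> in both \<open>U\<close> and \<open>T\<close>
    would form a claw at \<open>x\<close> together with \<open>c\<close>. So \<open>c\<close> is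
    complete to one side, as the preceding lemma demands.\<close>
  have "(\<forall>u \<in> U. E c u) \<or> (\<forall>v \<in> T. E c v)" if "E x c"
  proof (rule ccontr)
    assume "\<not> ?thesis"
    then obtain u v where uv: "u \<in> U" "v \<in> T" "\<not> E c u" "\<not> E c v" by blast
    moreover from this have "E x u" "E x v" "u \<noteq> c" "v \<noteq> c" "u \<noteq> v" using UT(1,2) by auto
    ultimately show False using three_nbrs[of x c u v] that none by blast
  qed
  then consider "E x c \<Longrightarrow> \<forall>u \<in> U. E c u" | "E x c \<Longrightarrow> \<forall>v \<in> T. E c v" by blast
  then show ?thesis
  proof cases
    case 1
    then show ?thesis using max_cliques_cut[OF x UT(1,3,4,2) none] by blast
  next
    case 2
    have "T \<union> U = {v. E x v} - {c}" "T \<inter> U = {}" using UT by auto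
    then show ?thesis using max_cliques_cut[OF x _ UT(4,3) _ none'] 2 by blast
  qed
qed

end

section \<open>Leaving out redundant triangles\<close>

locale split_eligible = finite_claw_free +
  fixes a b :: 'a
  assumes split: "eligible E x \<Longrightarrow> split_nbhd E x a b"
begin

text \<open>Among maximal cliques these are triangles made of an eligible vertex, one of
  \<open>a\<close> and \<open>b\<close>, and a far vertex, by \<open>redundant_cases\<close>. The
  condition is not tied to one eligible vertex, so that the same family is left out
  everywhere.\<close>

definition redundant :: "'a set \<Rightarrow> bool" where
  "redundant Q \<longleftrightarrow> (a \<in> Q \<or> b \<in> Q) \<and> (\<exists>x \<in> Q. eligible E x) \<and>
     (\<exists>w \<in> Q - {a, b}. \<not> (E a w \<and> E b w))"

lemma swap: "split_eligible E V b a"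
proof unfold_locales
  fix x assume "eligible E x"
  then have "split_nbhd E x a b" by (rule split)
  moreover have "near E x b a = near E x a b" "far E x b a = far E x a b"
    by (auto simp: near_def far_def)
  ultimately show "split_nbhd E x b a" by (auto simp: split_nbhd_def)
qed

lemma eligible_adj:
  assumes "eligible E x" shows "E x a" "E x b" "E a x" "E b x" "x \<noteq> a" "x \<noteq> b" "a \<noteq> b"
  using split[OF assms] sym irrefl unfolding split_nbhd_def by blast+

text \<open>A fourth vertex is not \<open>b\<close>, which is not adjacent to \<open>w\<close>. It
  cannot be near, as near and far vertices are not adjacent, nor far, as \<open>a\<close> has only
  one far neighbour.\<close>

lemma redundant_a:
  assumes Q: "max_clique Q" "redundant Q" "a \<in> Q"
  obtains x w where "eligible E x" "w \<in> far E x a b" "E a w" "Q = {x, a, w}"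
proof -
  obtain x w where x: "x \<in> Q" "eligible E x" and w: "w \<in> Q" "w \<noteq> a" "w \<noteq> b" "\<not> (E a w \<and> E b w)"
    using Q(2) by (auto simp: redundant_def)
  note adj = eligible_adj[OF x(2)]
  note S = split[OF x(2), unfolded split_nbhd_def]
  have aw: "E a w" using max_clique_adj[OF Q(1,3) w(1)] w by auto
  have "w \<noteq> x" using w adj by blast
  then have xw: "E x w" using max_clique_adj[OF Q(1) x(1) w(1)] by auto
  then have far: "w \<in> far E x a b" using w by (simp add: far_def)
  have nbw: "\<not> E w b" "\<not> E b w" using w aw sym by blast+
  have "q = x \<or> q = a \<or> q = w" if q: "q \<in> Q" for q
  proof (rule ccontr)
    assume ne: "\<not> ?thesis"
    have e: "E x q" "E a q" "E q w"
      using max_clique_adj[OF Q(1)] x(1) Q(3) w(1) q ne by metis+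
    have "q \<noteq> b" using e(3) nbw by blast
    then have "q \<in> near E x a b \<or> q \<in> far E x a b" using e ne by (auto simp: near_def far_def)
    then show False using S e far aw ne unfolding link_far_def by blast
  qed
  then have "Q = {x, a, w}" using x Q w by blast
  then show thesis using that x far aw by blast
qed

lemma redundant_cases:
  assumes Q: "max_clique Q" "redundant Q"
  obtains x w where "eligible E x" "w \<in> far E x a b" "Q = {x, a, w}" "E a w"
  | x w where "eligible E x" "w \<in> far E x a b" "Q = {x, b, w}" "E b w"
proof -
  interpret s: split_eligible E V b a by (rule swap)
  have "s.redundant Q" using Q(2) by (auto simp: redundant_def s.redundant_def)
  moreover have "far E x b a = far E x a b" for x by (auto simp: far_def)
  ultimately show thesis
    using Q redundant_a[of Q] s.redundant_a[of Q] that by (metis redundant_def)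
qed

text \<open>Each edge of a left-out triangle lies in another triangle whose extension to a maximal
  clique is kept: \<open>x a\<close> with a near vertex, \<open>x w\<close> with a second far
  vertex, and \<open>a w\<close> with the vertex \<open>z\<close> from
  \<open>link_far\<close>.\<close>

lemma covered_a:
  assumes x: "eligible E x" and w: "w \<in> far E x a b" "E a w"
    and uv: "u \<in> {x, a, w}" "v \<in> {x, a, w}" "u \<noteq> v"
  shows "\<exists>Q. max_clique Q \<and> \<not> redundant Q \<and> u \<in> Q \<and> v \<in> Q"
proof -
  note adj = eligible_adj[OF x]
  note S = split[OF x, unfolded split_nbhd_def]
  have V: "x \<in> V" "a \<in> V" "w \<in> V" using adj w E_in_V by blast+
  have wx: "E x w" "w \<noteq> a" "w \<noteq> b" "\<not> E b w" "w \<noteq> x" using w adj by (auto simp: far_def)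
  have el: "E a y \<and> E b y \<and> y \<noteq> a \<and> y \<noteq> b" if "eligible E y" for y using eligible_adj[OF that] by blast
  obtain k where k: "k \<in> near E x a b" using S by blast
  then have k': "E x k" "E a k" "E b k" "k \<noteq> a" "k \<noteq> b" "k \<noteq> x" using irrefl by (auto simp: near_def)
  have 1: "\<exists>Q. max_clique Q \<and> \<not> redundant Q \<and> x \<in> Q \<and> a \<in> Q"
  proof -
    have "clique E {x, a, k}" using adj k' by (intro clique_triple)
    moreover have "{x, a, k} \<subseteq> V" using V k' E_in_V by blast
    ultimately obtain Q where Q: "max_clique Q" "{x, a, k} \<subseteq> Q" by (rule extend_clique)
    \<comment> \<open>A redundant triangle contains a vertex other than \<open>a\<close> and
      \<open>b\<close> that is not adjacent to both, whereas \<open>x\<close> and \<open>k\<close>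
      are.\<close>
    have "\<not> redundant Q"
    proof
      assume "redundant Q"
      then show False
      proof (rule redundant_cases[OF Q(1)])
        fix y z assume yz: "eligible E y" "z \<in> far E y a b" "Q = {y, a, z}" "E a z"
        then have "z = x \<or> z = k" using Q(2) k' adj by auto
        then show False using yz(2,4) adj k' by (auto simp: far_def)
      next
        fix y z assume yz: "eligible E y" "z \<in> far E y a b" "Q = {y, b, z}" "E b z"
        then have "z = x \<or> z = k" using Q(2) k' adj by auto
        then show False using yz(2,4) adj k' by (auto simp: far_def)
      qed
    qed
    then show ?thesis using Q by blast
  qed
  have 2: "\<exists>Q. max_clique Q \<and> \<not> redundant Q \<and> x \<in> Q \<and> w \<in> Q"
  proof -
    obtain w' where w': "w' \<in> far E x a b" "w' \<noteq> w" using S by metis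
    then have ww: "E w w'" "E x w'" "w' \<noteq> a" "w' \<noteq> b" "w' \<noteq> x"
    proof -
      have "\<forall>u \<in> far E x a b. \<forall>v \<in> far E x a b. u \<noteq> v \<longrightarrow> E u v" using S by (elim conjE)
      from this[THEN bspec, OF w(1), THEN bspec, OF w'(1)] show "E w w'" using w'(2) by simp
      show "E x w'" "w' \<noteq> a" "w' \<noteq> b" using w'(1) by (simp_all add: far_def)
      show "w' \<noteq> x" using \<open>E x w'\<close> irrefl by metis
    qed
    have "clique E {x, w, w'}" using wx ww by (intro clique_triple)
    moreover have "{x, w, w'} \<subseteq> V" using V ww E_in_V by blast
    ultimately obtain Q where Q: "max_clique Q" "{x, w, w'} \<subseteq> Q" by (rule extend_clique)
    have "\<not> redundant Q"
    proof
      assume "redundant Q"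
      then show False
      proof (rule redundant_cases[OF Q(1)])
        fix y z assume "Q = {y, a, z}"
        then show False using Q(2) wx ww w' adj by auto
      next
        fix y z assume "Q = {y, b, z}"
        then show False using Q(2) wx ww w' adj by auto
      qed
    qed
    then show ?thesis using Q by blast
  qed
  have 3: "\<exists>Q. max_clique Q \<and> \<not> redundant Q \<and> a \<in> Q \<and> w \<in> Q"
  proof -
    have "link_far E x a b" using S by (elim conjE)
    then obtain z where z: "z \<noteq> x" "\<not> E x z" "E a z" "E w z" "\<not> E b z"
      using w unfolding link_far_def by metis
    have "clique E {a, w, z}" using w z by (intro clique_triple)
    moreover have "{a, w, z} \<subseteq> V" using V z E_in_V by blast
    ultimately obtain Q where Q: "max_clique Q" "{a, w, z} \<subseteq> Q" by (rule extend_clique)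
    have ne: "z \<noteq> a" "z \<noteq> w" "z \<noteq> b" using z adj irrefl by metis+
    \<comment> \<open>Neither \<open>w\<close> nor \<open>z\<close> is eligible, not being adjacent
      to \<open>b\<close>.\<close>
    have "\<not> redundant Q"
    proof
      assume "redundant Q"
      then show False
      proof (rule redundant_cases[OF Q(1)])
        fix y q assume yq: "eligible E y" "Q = {y, a, q}"
        then have "y = w \<or> y = z" using Q(2) ne wx el[of y] by auto
        then show False using el[OF yq(1)] wx z by auto
      next
        fix y q assume yq: "eligible E y" "Q = {y, b, q}"
        then show False using Q(2) ne wx adj by auto
      qed
    qed
    then show ?thesis using Q by blast
  qed
  show ?thesis using uv 1 2 3 by blast
qed

lemma covered:
  assumes "E u v"
  shows "\<exists>Q. max_clique Q \<and> \<not> redundant Q \<and> u \<in> Q \<and> v \<in> Q"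
proof -
  interpret s: split_eligible E V b a by (rule swap)
  have r: "s.redundant Q = redundant Q" for Q by (auto simp: redundant_def s.redundant_def)
  have f: "far E x b a = far E x a b" for x by (auto simp: far_def)
  have ne: "u \<noteq> v" using assms irrefl by blast
  have "clique E {u, v}" using assms by (rule clique_pair)
  moreover have "{u, v} \<subseteq> V" using E_in_V[OF assms] E_in_V[OF sym[OF assms]] by simp
  ultimately obtain Q where Q: "max_clique Q" "{u, v} \<subseteq> Q" by (rule extend_clique)
  show ?thesis
  proof (cases "redundant Q")
    case False
    then show ?thesis using Q by blast
  next
    case True
    then show ?thesis
    proof (rule redundant_cases[OF Q(1)])
      fix x w assume "eligible E x" "w \<in> far E x a b" "Q = {x, a, w}" "E a w"
      then show ?thesis using covered_a[of x w u v] Q ne by blast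
    next
      fix x w assume "eligible E x" "w \<in> far E x a b" "Q = {x, b, w}" "E b w"
      then show ?thesis using s.covered_a[of x w u v] Q ne r f by auto
    qed
  qed
qed

text \<open>At an eligible \<open>x\<close>, a kept clique that meets the far set avoids
  \<open>a\<close>, \<open>b\<close> and the near set. Any other one consists of \<open>x\<close>,
  near vertices and possibly \<open>a\<close> or \<open>b\<close>; as the near set is complete to
  both, maximality determines it once membership of \<open>a\<close> is known.\<close>

lemma few_cliques:
  assumes "x \<in> V"
  shows "card {Q. max_clique Q \<and> \<not> redundant Q \<and> x \<in> Q} \<le> 3"
proof (cases "eligible E x")
  case False
  have "finite {Q. max_clique Q \<and> x \<in> Q}" using finite_max_cliques by (rule rev_finite_subset) auto
  then have "card {Q. max_clique Q \<and> \<not> redundant Q \<and> x \<in> Q} \<le> card {Q. max_clique Q \<and> x \<in> Q}"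
    by (rule card_mono) auto
  then show ?thesis using max_cliques_not_eligible[OF assms False] by simp
next
  case True
  note adj = eligible_adj[OF True]
  note S = split[OF True, unfolded split_nbhd_def]
  let ?K = "near E x a b" and ?A = "far E x a b"
  have cK: "clique E ?K" "clique E ?A" using S by (auto simp: clique_def)
  have sub: "?K \<subseteq> {v. E x v}" "?A \<subseteq> {v. E x v}" by (auto simp: near_def far_def)
  have cKb: "clique E (insert b ?K)" using cK(1) by (rule clique_insert) (simp add: near_def)
  have cKa: "clique E (insert a ?K)" using cK(1) by (rule clique_insert) (simp add: near_def)
  have cKab: "clique E (insert a (insert b ?K))" if "E a b"
    using cKb by (rule clique_insert) (use that in \<open>auto simp: near_def\<close>)
  have sub': "insert a ?K \<subseteq> {v. E x v}" "insert b ?K \<subseteq> {v. E x v}" "insert a (insert b ?K) \<subseteq> {v. E x v}"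
    using sub adj by auto
  \<comment> \<open>The kept clique through \<open>x\<close> and \<open>a\<close> also takes in
    \<open>b\<close> precisely when \<open>a\<close> and \<open>b\<close> are adjacent.\<close>
  define Ka where "Ka = (if E a b then insert a (insert b ?K) else insert a ?K)"
  have "{Q. max_clique Q \<and> \<not> redundant Q \<and> x \<in> Q} \<subseteq> {insert x ?A, insert x Ka, insert x (insert b ?K)}"
  proof (rule subsetI)
    fix Q assume "Q \<in> {Q. max_clique Q \<and> \<not> redundant Q \<and> x \<in> Q}"
    then have Q: "max_clique Q" "\<not> redundant Q" "x \<in> Q" by auto
    have mem: "v = x \<or> v = a \<or> v = b \<or> v \<in> ?K \<or> v \<in> ?A" if "v \<in> Q" for v
      using max_clique_adj[OF Q(1,3) that] by (auto simp: near_def far_def)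
    show "Q \<in> {insert x ?A, insert x Ka, insert x (insert b ?K)}"
    proof (cases "Q \<inter> ?A = {}")
      case True
      show ?thesis
      proof (cases "a \<in> Q")
        case aQ: True
        have "E a b" if "b \<in> Q" using max_clique_adj[OF Q(1) aQ that] adj by blast
        then have "Q \<subseteq> insert x Ka" using mem True by (auto simp: Ka_def)
        moreover have "clique E Ka" "Ka \<subseteq> {v. E x v}" using cKa cKab sub' by (auto simp: Ka_def)
        ultimately show ?thesis using max_clique_eqI[OF Q(1) _ assms] by blast
      next
        case False
        then have "Q \<subseteq> insert x (insert b ?K)" using mem True by blast
        then show ?thesis using max_clique_eqI[OF Q(1) _ assms cKb sub'(2)] by blast
      qed
    next
      case False
      then obtain w where w: "w \<in> Q" "w \<in> ?A" by blast
      then have "\<not> (a \<in> Q \<or> b \<in> Q)" using Q \<open>eligible E x\<close> by (auto simp: redundant_def far_def)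
      moreover have "v \<notin> ?K" if "v \<in> Q" for v
      proof
        assume v: "v \<in> ?K"
        then have "v \<noteq> w" using w by (auto simp: near_def far_def)
        then show False using max_clique_adj[OF Q(1) that w(1)] v w(2) S by blast
      qed
      ultimately have "Q \<subseteq> insert x ?A" using mem by blast
      then show ?thesis using max_clique_eqI[OF Q(1) _ assms cK(2) sub(2)] by blast
    qed
  qed
  then show ?thesis by (rule card_le_3)
qed

end

section \<open>Local completions and Tutte paths\<close>

abbreviation adj :: "'a pair_pre_digraph \<Rightarrow> 'a \<Rightarrow> 'a \<Rightarrow> bool" where
  "adj G u v \<equiv> (u, v) \<in> parcs G"

lemma set_vwalk_arcs: "set (vwalk_arcs p) \<subseteq> S \<longleftrightarrow> successively (\<lambda>u v. (u, v) \<in> S) p"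
  by (induction p rule: vwalk_arcs.induct) auto

lemma vpath_iff:
  "vpath p (with_proj G) \<longleftrightarrow> p \<noteq> [] \<and> distinct p \<and> set p \<subseteq> pverts G \<and> successively (adj G) p"
  by (auto simp: vpath_def vwalk_def set_vwalk_arcs)

lemma claw_free_imp_rel:
  assumes "pair_graph G" "claw_free G"
  shows "claw_free_rel (adj G)"
proof -
  interpret pair_graph G by fact
  have sym: "adj G u v \<Longrightarrow> adj G v u" for u v
    using pair_sym_arcs by (auto simp: symmetric_def dest: symD)
  have irrefl: "\<not> adj G u u" for u using pair_no_loops by fastforce
  show ?thesis
  proof unfold_locales
    fix c p q r
    assume cl: "adj G c p" "adj G c q" "adj G c r" "p \<noteq> q" "p \<noteq> r" "q \<noteq> r"
    show "adj G p q \<or> adj G p r \<or> adj G q r"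
    proof (rule ccontr)
      assume no: "\<not> ?thesis"
      \<comment> \<open>The star on \<open>c\<close>, \<open>p\<close>, \<open>q\<close>,
        \<open>r\<close>, as a graph of its own, so that it can be shown to be an induced copy of
        \<open>K_{1,3}\<close>.\<close>
      define H where "H = \<lparr>pverts = {c, p, q, r}, parcs = {c} \<times> {p, q, r} \<union> {p, q, r} \<times> {c}\<rparr>"
      have c: "c \<noteq> p" "c \<noteq> q" "c \<noteq> r" using cl irrefl by auto
      have K: "complete_bipartite_digraph 1 3 (with_proj H)"
        unfolding complete_bipartite_digraph_pair_def
        using c cl by (intro conjI exI[of _ "{c}"] exI[of _ "{p, q, r}"]) (auto simp: H_def)
      then interpret H: pair_graph H by (rule pair_graphI_complete_bipartite)
      have ends: "c \<in> pverts G" "p \<in> pverts G" "q \<in> pverts G" "r \<in> pverts G"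
        using cl in_arcsD1 in_arcsD2 by blast+
      have cl': "adj G p c" "adj G q c" "adj G r c" using cl(1-3)[THEN sym] by auto
      have no': "\<not> adj G q p" "\<not> adj G r p" "\<not> adj G r q" using no sym by blast+
      have "\<forall>u \<in> pverts H. \<forall>v \<in> pverts H. (u, v) \<in> parcs H \<longleftrightarrow> adj G u v"
        using cl cl' no no' irrefl c by (simp add: H_def)
      moreover have "parcs H \<subseteq> pverts H \<times> pverts H" unfolding H_def by auto
      ultimately have arcs: "parcs H = {e \<in> parcs G. fst e \<in> pverts H \<and> snd e \<in> pverts H}"
        by fastforce
      have "subgraph (with_proj H) (with_proj G)"
        using ends arcs wf_digraph_axioms H.wf_digraph_axioms
        by (intro subgraphI) (auto simp: H_def compatible_def)
      then have "induced_subgraph (with_proj H) (with_proj G)"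
        unfolding induced_subgraph_def with_proj_simps using arcs by (rule conjI)
      then show False using assms(2) K unfolding claw_free_def by metis
    qed
  qed (fact sym irrefl)+
qed

lemma adj_local_completion:
  "adj (local_completion G x) u v \<longleftrightarrow> adj G u v \<or> adj G x u \<and> adj G x v \<and> u \<noteq> v"
  by (auto simp: local_completion_def nbhd_def)

lemma pverts_local_completion [simp]: "pverts (local_completion G x) = pverts G"
  by (simp add: local_completion_def)

lemma pair_graph_local_completion:
  assumes "pair_graph G" shows "pair_graph (local_completion G x)"
proof -
  interpret pair_graph G by fact
  have sub: "parcs (local_completion G x) \<subseteq> pverts G \<times> pverts G"
    using in_arcsD1 in_arcsD2 by (auto simp: local_completion_def nbhd_def)
  have "finite (parcs (local_completion G x))"
    using sub pair_finite_verts by (auto intro: finite_subset)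
  moreover have "symmetric (local_completion G x)"
    using pair_sym_arcs by (auto simp: symmetric_def sym_def adj_local_completion)
  moreover have "u \<noteq> v" if "adj (local_completion G x) u v" for u v
    using that pair_no_loops by (fastforce simp: adj_local_completion)
  ultimately show ?thesis
    using sub pair_finite_verts by unfold_locales auto
qed

text \<open>If an edge \<open>c p\<close> of a claw comes from completing, the other leaves lie
  outside \<open>N(x)\<close>, as they would be adjacent to \<open>p\<close> otherwise. Hence their
  edges to \<open>c\<close> are old, and with \<open>x\<close> they form a claw at \<open>c\<close>
  in \<open>G\<close>; neither of them is \<open>x\<close>, which is adjacent to
  \<open>p\<close>.\<close>

lemma claw_free_local_completion:
  assumes "claw_free_rel (adj G)"
  shows "claw_free_rel (adj (local_completion G x))"
proof -
  interpret claw_free_rel "adj G" by fact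
  show ?thesis
  proof unfold_locales
    fix u v assume "adj (local_completion G x) u v"
    then show "adj (local_completion G x) v u" using sym unfolding adj_local_completion by metis
  next
    fix u show "\<not> adj (local_completion G x) u u" using irrefl unfolding adj_local_completion by metis
  next
    have new: "adj (local_completion G x) q r"
      if e: "adj G x c" "adj G x p" "adj (local_completion G x) c q" "adj (local_completion G x) c r"
        "p \<noteq> q" "p \<noteq> r" "q \<noteq> r" "\<not> adj (local_completion G x) p q" "\<not> adj (local_completion G x) p r"
      for c p q r
    proof -
      have out: "\<not> adj G x q" "\<not> adj G x r" using e unfolding adj_local_completion by metis+
      then have in_G: "adj G c q" "adj G c r" using e unfolding adj_local_completion by metis+
      have "adj G c x" using e(1) by (rule sym)
      show ?thesis
      proof (cases "q = x \<or> r = x")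
        case True
        then show ?thesis using sym[OF e(2)] e(8,9) unfolding adj_local_completion by metis
      next
        case False
        then have "adj G q r" using no_claw[of c x q r] \<open>adj G c x\<close> in_G out e(7) by metis
        then show ?thesis unfolding adj_local_completion by metis
      qed
    qed
    fix c p q r
    let ?E = "adj (local_completion G x)"
    assume cl: "?E c p" "?E c q" "?E c r" "p \<noteq> q" "p \<noteq> r" "q \<noteq> r"
    show "?E p q \<or> ?E p r \<or> ?E q r"
    proof (cases "adj G c p \<and> adj G c q \<and> adj G c r")
      case True
      then show ?thesis using no_claw[of c p q r] cl unfolding adj_local_completion by metis
    next
      case False
      have flip: "?E u v \<longleftrightarrow> ?E v u" for u v unfolding adj_local_completion using sym by metis
      from False consider "adj G x c" "adj G x p" | "adj G x c" "adj G x q" | "adj G x c" "adj G x r"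
        using cl(1-3) unfolding adj_local_completion by metis
      then show ?thesis
      proof cases
        case 1 then show ?thesis using new[of c p q r] cl by metis
      next
        case 2 then show ?thesis using new[of c q p r] cl flip by metis
      next
        case 3 then show ?thesis using new[of c r p q] cl flip by metis
      qed
    qed
  qed
qed

text \<open>Without the path, each component of \<open>G\<close> lies inside a component of
  \<open>G'\<close>, which has at least the same neighbours on the path. The bound on these depends
  only on the vertex set of the path.\<close>

lemma tutte_path_subgraph:
  assumes G: "pair_graph G" "pair_graph G'" "pverts G = pverts G'" "parcs G \<subseteq> parcs G'"
    and p: "tutte_path G' p" and q: "vpath q (with_proj G)" "set q = set p"
  shows "tutte_path G q"
proof -
  interpret G: pair_graph G by fact
  interpret G': pair_graph G' by fact
  let ?S = "pverts G - set p"
  let ?H = "with_proj G \<restriction> ?S" and ?H' = "with_proj G' \<restriction> ?S"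
  interpret H: wf_digraph ?H by (rule G.wellformed_induce_subgraph)
  interpret H': wf_digraph ?H' by (rule G'.wellformed_induce_subgraph)
  have sub: "subgraph ?H ?H'"
    using G(4) H.wf_digraph_axioms H'.wf_digraph_axioms
    by (intro subgraphI) (auto simp: compatible_def)
  have "card {v \<in> set q. \<exists>u \<in> C. v \<in> nbhd G u} \<le> min 3 (card (set q) - 1)"
    if C: "C \<in> pre_digraph.sccs_verts (with_proj G \<restriction> (pverts G - set q))" for C
  proof -
    have C': "C \<in> pre_digraph.sccs_verts ?H" using C q(2) by simp
    then obtain u where u: "u \<in> C" by (auto simp: H.in_sccs_verts_conv_reachable)
    have reach: "u \<rightarrow>\<^sup>*\<^bsub>?H\<^esub> v" "v \<rightarrow>\<^sup>*\<^bsub>?H\<^esub> u" if "v \<in> C" for v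
      using C' u that by (auto simp: H.in_sccs_verts_conv_reachable)
    have "u \<in> verts ?H'" using H.reachable_in_verts(1)[OF reach(1)[OF u]] by simp
    then have D: "H'.scc_of u \<in> H'.sccs_verts" by (rule H'.scc_of_in_sccs_verts)
    have CD: "C \<subseteq> H'.scc_of u"
      using reach H'.reachable_mono[OF _ sub] by (auto simp: H'.scc_of_def)
    have "card {v \<in> set q. \<exists>u \<in> C. v \<in> nbhd G u} \<le> card {v \<in> set p. \<exists>w \<in> H'.scc_of u. v \<in> nbhd G' w}"
      using CD G(4) q(2) by (intro card_mono) (auto simp: nbhd_def)
    also have "\<dots> \<le> min 3 (card (set p) - 1)"
      using p D G(3) by (auto simp: tutte_path_def)
    finally show ?thesis using q(2) by simp
  qed
  then show ?thesis using q(1) by (simp add: tutte_path_def)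
qed

lemma not_successively_split:
  "\<not> successively P p \<Longrightarrow> \<exists>L u v R. p = L @ [u, v] @ R \<and> \<not> P u v"
proof (induction p)
  case (Cons u p)
  show ?case
  proof (cases "successively P p")
    case True
    then have "p \<noteq> []" "\<not> P u (hd p)" using Cons.prems by (auto simp: successively_Cons)
    then show ?thesis by (intro exI[of _ "[]"] exI[of _ u] exI[of _ "hd p"] exI[of _ "tl p"]) simp
  next
    case False
    then obtain L u' v R where "p = L @ [u', v] @ R" "\<not> P u' v" using Cons.IH by blast
    then show ?thesis by (metis append_Cons)
  qed
qed simp

text \<open>Let \<open>p\<close> be a maximal Tutte path of the completion. An
  \<open>(a, b)\<close>-path of \<open>G\<close> on the same vertices would be maximal in
  \<open>G\<close>, whose paths are also paths of the completion, and it would be a Tutte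
  path.\<close>

lemma split_nbhd_of_pair:
  assumes G: "pair_graph G" "claw_free_rel (adj G)"
    and x: "eligible (adj G) x" "tutte_connected (local_completion G x)"
    and ab: "a \<in> pverts G" "b \<in> pverts G" "a \<noteq> b"
    and no: "\<not> (\<exists>p. maximal_path_between G a b p \<and> tutte_path G p)"
  shows "split_nbhd (adj G) x a b"
proof -
  let ?G' = "local_completion G x"
  interpret pair_graph G by fact
  interpret c: claw_free_rel "adj G" by fact
  obtain p where p: "maximal_path_between ?G' a b p" "tutte_path ?G' p"
    using x(2) ab unfolding tutte_connected_def pverts_local_completion by blast
  have path: "p \<noteq> []" "distinct p" "set p \<subseteq> pverts G" "successively (adj ?G') p" "hd p = a" "last p = b"
    using p(1) by (auto simp: maximal_path_between_def path_between_def vpath_iff)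
  have sub: "path_between G a b q \<Longrightarrow> path_between ?G' a b q" for q
    unfolding path_between_def vpath_iff pverts_local_completion
    by (auto elim: successively_mono simp: adj_local_completion)
  have not_in_G: "\<not> path_between G a b q" if q: "set q = set p" for q
  proof
    assume pq: "path_between G a b q"
    have "maximal_path_between G a b q"
      using pq p(1) sub q unfolding maximal_path_between_def by metis
    moreover have "tutte_path G q"
    proof (rule tutte_path_subgraph[OF G(1) pair_graph_local_completion[OF G(1)] _ _ p(2)])
      show "vpath q (with_proj G)" using pq by (simp add: path_between_def)
    qed (use q in \<open>auto simp: local_completion_def\<close>)
    ultimately show False using no by blast
  qed
  have "\<not> successively (adj G) p"
    using not_in_G[of p] path by (simp add: path_between_def vpath_iff)
  then obtain L u v R where split: "p = L @ [u, v] @ R" "\<not> adj G u v"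
    using not_successively_split by blast
  have "adj ?G' u v" using path(4) by (simp add: split(1) successively_append_iff)
  then have uv: "adj G x u" "adj G x v" using split(2) by (auto simp: adj_local_completion)
  \<comment> \<open>A vertex of the closed neighbourhood of \<open>x\<close> off the path could be
    inserted into the added edge \<open>u v\<close>, against maximality.\<close>
  have inside: "y \<in> set p" if y: "y = x \<or> adj G x y" for y
  proof (rule ccontr)
    assume new: "y \<notin> set p"
    have ne: "u \<noteq> y" "y \<noteq> v" using new split(1) by auto
    have e: "adj ?G' u y" "adj ?G' y v"
      using y uv ne c.sym[OF uv(1)] unfolding adj_local_completion by metis+
    have "y \<in> pverts G" using y uv(1) in_arcsD1 in_arcsD2 by blast
    then have "path_between ?G' a b (L @ [u, y, v] @ R)"
      using path new e by (auto simp: path_between_def vpath_iff split(1) successively_append_iff successively_Cons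
          hd_append last_append)
    moreover have "set p \<subset> set (L @ [u, y, v] @ R)" using new by (auto simp: split(1))
    ultimately show False using p(1) unfolding maximal_path_between_def by blast
  qed
  interpret cc: clique_closing "adj G" x "set p"
    by unfold_locales (simp_all add: inside)
  interpret cc: clique_closing_2conn "adj G" x "set p"
    using x(1) unfolding eligible_def twice_connected_def cc.N_def[symmetric]
    by unfold_locales metis
  have "cc.closed_adj = adj ?G'"
    by (simp add: cc.closed_adj_def adj_local_completion fun_eq_iff)
  then have "successively cc.closed_adj p" using path(4) by simp
  moreover have "\<not> (\<exists>q. cc.spans a b q)"
    using not_in_G path(3) by (auto simp: cc.spans_def path_between_def vpath_iff)
  ultimately show ?thesis using cc.split_nbhd_if_not_spans path ab(3) by blast
qed

section \<open>Line graphs from clique covers\<close>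

lemma line_graph_of_clique_cover:
  assumes G: "pair_graph G" and finite: "finite \<Q>"
    and cliques: "\<And>Q u v. Q \<in> \<Q> \<Longrightarrow> u \<in> Q \<Longrightarrow> v \<in> Q \<Longrightarrow> u \<in> pverts G \<Longrightarrow> v \<in> pverts G \<Longrightarrow> u \<noteq> v \<Longrightarrow> adj G u v"
    and cover: "\<And>u v. adj G u v \<Longrightarrow> \<exists>Q \<in> \<Q>. u \<in> Q \<and> v \<in> Q"
    and few: "\<And>v. v \<in> pverts G \<Longrightarrow> card {Q \<in> \<Q>. v \<in> Q} \<le> 3"
  shows "\<exists>H :: (nat, nat) hypergraph. finite_hypergraph H \<and> hypergraph_rank H \<le> 3 \<and>
    digraph_iso (with_proj G) (with_proj (line_graph H))"
proof -
  interpret pair_graph G by fact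
  obtain f :: "'a \<Rightarrow> nat" where f: "inj_on f (pverts G)"
    using finite_imp_inj_to_nat_seg[OF pair_finite_verts] by blast
  obtain g :: "'a set \<Rightarrow> nat" where g: "inj_on g \<Q>"
    using finite_imp_inj_to_nat_seg[OF finite] by blast
  \<comment> \<open>Krausz's dual construction: the cliques become the ground set, and a vertex
    becomes the set of cliques that contain it. The injections \<open>f\<close> and \<open>g\<close>
    rename vertices and cliques by natural numbers.\<close>
  define es where "es n = g ` {Q \<in> \<Q>. inv_into (pverts G) f n \<in> Q}" for n
  define H where "H = \<lparr>ground = g ` \<Q>, edge_names = f ` pverts G, edge_set = es\<rparr>"
  have es: "es (f v) = g ` {Q \<in> \<Q>. v \<in> Q}" if "v \<in> pverts G" for v
    using inv_into_f_f[OF f that] by (simp add: es_def)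
  have "finite_hypergraph H"
    using finite pair_finite_verts by (auto simp: finite_hypergraph_def H_def es_def)
  moreover have "hypergraph_rank H \<le> 3"
  proof -
    have "card (es (f v)) \<le> 3" if "v \<in> pverts G" for v
    proof -
      have "card (es (f v)) \<le> card {Q \<in> \<Q>. v \<in> Q}"
        unfolding es[OF that] using finite by (intro card_image_le) auto
      also have "\<dots> \<le> 3" by (rule few[OF that])
      finally show ?thesis .
    qed
    then show ?thesis
      using pair_finite_verts by (auto simp: hypergraph_rank_def H_def)
  qed
  moreover have "digraph_iso (with_proj G) (with_proj (line_graph H))"
    unfolding digraph_iso_def
  proof (intro exI conjI)
    let ?h = "\<lparr>iso_verts = f, iso_arcs = map_prod f f, iso_head = snd, iso_tail = fst\<rparr>"
    have "inj_on (map_prod f f) (parcs G)"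
      using map_prod_inj_on[OF f f] by (rule inj_on_subset) (use in_arcsD1 in_arcsD2 in auto)
    then show "pre_digraph.digraph_isomorphism (with_proj G) ?h"
      using f wf_digraph_axioms by (auto simp: pre_digraph.digraph_isomorphism_def)
    have meet: "es (f u) \<inter> es (f v) \<noteq> {} \<longleftrightarrow> adj G u v"
      if V: "u \<in> pverts G" "v \<in> pverts G" "u \<noteq> v" for u v
    proof
      assume "es (f u) \<inter> es (f v) \<noteq> {}"
      then obtain Q Q' where "Q \<in> \<Q>" "Q' \<in> \<Q>" "u \<in> Q" "v \<in> Q'" "g Q = g Q'"
        unfolding es[OF V(1)] es[OF V(2)] by auto
      moreover from this have "Q = Q'" using g by (auto dest: inj_onD)
      ultimately show "adj G u v" using cliques V by blast
    next
      assume "adj G u v"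
      then obtain Q where "Q \<in> \<Q>" "u \<in> Q" "v \<in> Q" using cover by blast
      then have "g Q \<in> es (f u) \<inter> es (f v)" using V by (simp add: es)
      then show "es (f u) \<inter> es (f v) \<noteq> {}" by blast
    qed
    have "parcs (line_graph H) = map_prod f f ` parcs G"
    proof (intro set_eqI iffI)
      fix e assume "e \<in> parcs (line_graph H)"
      then obtain u v where uv: "e = (f u, f v)" "u \<in> pverts G" "v \<in> pverts G" "f u \<noteq> f v"
          "es (f u) \<inter> es (f v) \<noteq> {}"
        by (auto simp: line_graph_def H_def)
      then have "adj G u v" using meet[of u v] by auto
      then show "e \<in> map_prod f f ` parcs G" using uv(1) by (metis map_prod_simp imageI)
    next
      fix e assume "e \<in> map_prod f f ` parcs G"
      then obtain u v where uv: "e = (f u, f v)" "adj G u v" by auto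
      then have V: "u \<in> pverts G" "v \<in> pverts G" "u \<noteq> v"
        using in_arcsD1 in_arcsD2 pair_no_loops by fastforce+
      then have "f u \<noteq> f v" using f by (auto dest: inj_onD)
      then show "e \<in> parcs (line_graph H)" using uv V meet by (auto simp: line_graph_def H_def)
    qed
    then show "with_proj (line_graph H) = app_iso ?h (with_proj G)"
      by (simp add: app_iso_def with_proj_def) (simp add: line_graph_def H_def)
  qed
  ultimately show ?thesis by blast
qed

text \<open>Completing at an eligible vertex changes the graph, so without a further
  \<open>tutte_step\<close> the result is Tutte-connected. The bad pair \<open>a\<close>,
  \<open>b\<close> is fixed first and thus shared by all eligible vertices.\<close>

lemma line_graph_of_maximal_completion:
  assumes G: "pair_graph G" "claw_free_rel (adj G)" "\<not> tutte_connected G"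
    and closed: "\<not> (\<exists>H. tutte_step G H)"
  shows "\<exists>H :: (nat, nat) hypergraph. finite_hypergraph H \<and> hypergraph_rank H \<le> 3 \<and>
    digraph_iso (with_proj G) (with_proj (line_graph H))"
proof -
  interpret pair_graph G by fact
  obtain a b where ab: "a \<in> pverts G" "b \<in> pverts G" "a \<noteq> b"
    "\<not> (\<exists>p. maximal_path_between G a b p \<and> tutte_path G p)"
    using G(3) unfolding tutte_connected_def by blast
  have split: "split_nbhd (adj G) x a b" if x: "eligible (adj G) x" for x
  proof -
    obtain u v where uv: "adj G x u" "adj G x v" "u \<noteq> v" "\<not> adj G u v"
      using x by (auto simp: eligible_def clique_def)
    then have "adj (local_completion G x) u v" by (simp add: adj_local_completion)
    then have "local_completion G x \<noteq> G" using uv(4) by metis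
    moreover have "x \<in> pverts G" using uv(1) by (rule in_arcsD1)
    ultimately have "tutte_connected (local_completion G x)"
      using closed unfolding tutte_step_def by blast
    then show ?thesis using split_nbhd_of_pair[OF G(1,2) x _ ab] by blast
  qed
  interpret s: split_eligible "adj G" "pverts G" a b
    using G(2) pair_finite_verts in_arcsD2 split
    by (intro split_eligible.intro finite_claw_free.intro finite_claw_free_axioms.intro
        split_eligible_axioms.intro) auto
  show ?thesis
  proof (rule line_graph_of_clique_cover[OF G(1), of "{Q. s.max_clique Q \<and> \<not> s.redundant Q}"])
    show "finite {Q. s.max_clique Q \<and> \<not> s.redundant Q}"
      using s.finite_max_cliques by (rule rev_finite_subset) auto
    show "card {Q \<in> {Q. s.max_clique Q \<and> \<not> s.redundant Q}. v \<in> Q} \<le> 3" if "v \<in> pverts G" for v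
      using s.few_cliques[OF that] by simp
  qed (use s.max_clique_adj s.covered in auto)
qed

theorem theorem6:
  fixes G GT :: "'a pair_pre_digraph"
  assumes "pair_graph G"
    and "claw_free G"
    and "tutte_closure G GT"
  shows "\<exists>H :: (nat, nat) hypergraph. finite_hypergraph H \<and> hypergraph_rank H \<le> 3 \<and>
           digraph_iso (with_proj GT) (with_proj (line_graph H))"
proof (cases "tutte_connected G")
  case True
  then have GT: "GT = complete_graph_on (pverts G)" using assms(3) by (simp add: tutte_closure_def)
  interpret pair_graph G by (rule assms(1))
  have "pair_graph GT"
  proof unfold_locales
    show "finite (parcs GT)"
      using pair_finite_verts by (auto simp: GT complete_graph_on_def intro: finite_subset[of _ "pverts G \<times> pverts G"])
  qed (use pair_finite_verts in \<open>auto simp: GT complete_graph_on_def symmetric_def intro: symI\<close>)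
  then show ?thesis
  \<comment> \<open>A complete graph is covered by a single clique.\<close>
  proof (rule line_graph_of_clique_cover[of _ "{pverts G}"])
    show "card {Q \<in> {pverts G}. v \<in> Q} \<le> 3" for v
      by (rule card_le_3[of _ "pverts G" "pverts G" "pverts G"]) auto
  qed (auto simp: GT complete_graph_on_def)
next
  case False
  then have steps: "tutte_step\<^sup>*\<^sup>* G GT" and closed: "\<not> (\<exists>H. tutte_step GT H)"
    using assms(3) by (auto simp: tutte_closure_def)
  \<comment> \<open>An invariant of the completion steps; the failure of Tutte-connectedness is part
    of \<open>tutte_step\<close>.\<close>
  from steps have "pair_graph GT \<and> claw_free_rel (adj GT) \<and> \<not> tutte_connected GT"
  proof induction
    case base
    show ?case using claw_free_imp_rel[OF assms(1,2)] assms(1) False by simp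
  next
    case (step H H')
    then obtain x where H': "H' = local_completion H x" "\<not> tutte_connected H'"
      unfolding tutte_step_def by metis
    show ?case
      unfolding H'(1)
      using step.IH H' pair_graph_local_completion[of H x] claw_free_local_completion[of H x] by simp
  qed
  then show ?thesis using line_graph_of_maximal_completion[of GT] closed by simp
qed

end
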